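(* For all permutations $I,J\in\mathfrak S_n$ the elements of the restriction matrix satisfy $$A_{I,J}(z,\mu)=(-1)^{n(n-1)/2}\,A_{J^{-1}\cdot\sigma_0,\;I^{-1}\cdot\sigma_0}\big(\mu_{\sigma_0(1)},\dots,\mu_{\sigma_0(n)},\,z_1^{-1},\dots,z_n^{-1}\big),$$ where $\sigma_0$ is the longest permutation in $\mathfrak S_n$.
   Context: Theta function. Fix $q\in\mathbb C^*$, $|q|<1$, and $$\vartheta(x)=(x^{1/2}-x^{-1/2})\,\phi(qx)\,\phi(q/x),\qquad \phi(x)=\prod_{s\ge 0}(1-q^s x).$$ (Functions involving $x^{1/2}$ are understood as functions of the logarithms of the variables.) Permutations. $I\in\mathfrak S_n$ is written $I=(I_1,\dots,I_n)$, $I_k=I(k)$. The product is $\sigma\cdot I=(I_{\sigma(1)},\dots,I_{\sigma(n)})$, i.e. $(\sigma\cdot I)(k)=I(\sigma(k))$; in particular $(I^{-1}\cdot\sigma_0)(k)=\sigma_0(I^{-1}(k))=n+1-I^{-1}(k)$, with $\sigma_0=(n,n-1,\dots,1)$. For $1\le k\le n$ write $\{i^{(k)}_1<\dots<i^{(k)}_k\}=\{I_1,\dots,I_k\}$. Elliptic weight functions. Let $t=(t^{(k)}_a)_{1\le a\le k\le n-1}$, $z=(z_1,\dots,z_n)$, $t^{(n)}_i=z_i$, $\mu=(\mu_1,\dots,\mu_n)$. Define $W_I(t,z,\hbar,\mu)=\mathrm{Sym}_{t^{(1)}}\cdots\mathrm{Sym}_{t^{(n-1)}}U_I(t,z,\hbar,\mu)$,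 where $\mathrm{Sym}_{t^{(k)}}$ is the sum over all permutations of $t^{(k)}_1,\dots,t^{(k)}_k$ and $$U_I=\prod_{k=1}^{n-1}\frac{\prod_{a=1}^{k}\prod_{c=1}^{k+1}\psi_{I,k,a,c}\big(t^{(k+1)}_c/t^{(k)}_a\big)}{\prod_{1\le a<b\le k}\vartheta\big(\hbar t^{(k)}_a/t^{(k)}_b\big)\,\vartheta\big(t^{(k)}_b/t^{(k)}_a\big)},$$ $$\psi_{I,k,a,c}(x)=\begin{cases}\vartheta(\hbar x), & i^{(k+1)}_c<i^{(k)}_a,\\ \vartheta\big(x\,\hbar^{1-p_{I,k+1}(i^{(k)}_a)}\,\mu_{k+1}/\mu_{j(I,k,a)}\big), & i^{(k+1)}_c=i^{(k)}_a,\\ \vartheta(x), & i^{(k+1)}_c>i^{(k)}_a.\end{cases}$$ Here $j(I,k,a)$ is the index with $I_{j(I,k,a)}=i^{(k)}_a$, and $p_{I,j}(m)=1$ if $I_j<m$, $p_{I,j}(m)=0$ if $I_j\ge m$. Restriction matrix. For $J\in\mathfrak S_n$ with $\{j^{(k)}_1<\dots<j^{(k)}_k\}=\{J_1,\dots,J_k\}$, let $z_J$ denote the substitution $t^{(k)}_a=z_{j^{(k)}_a}$ ($1\le a\le k\le n-1$). Then $A_{I,J}(z,\mu)=A_{I,J}(z_1,\dots,z_n,\mu_1,\dots,\mu_n)=W_I(z_J,z,\hbar,\mu)$ (it also depends on $\hbar$, which is the same on both sides of the identity). *)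

theory Defs
  imports "HOL-Analysis.Analysis" "HOL-Combinatorics.Permutations"
begin

text \<open>
  The theta function involves \<open>x\<^sup>1\<^sup>/\<^sup>2\<close> and is a function of the logarithm of its
  argument.  Therefore all variables below (\<open>t\<close>, \<open>z\<close>, \<open>\<mu>\<close> and \<open>\<hbar>\<close>) are represented by
  logarithms: products of variables become sums, inverses become negatives.  The parameter
  \<open>q\<close> only enters with integer powers and is an ordinary complex number.
  All index sets are 1-based, as \<open>{1..n}\<close>; values of sequences at other indices are irrelevant.
\<close>

definition phi :: "complex \<Rightarrow> complex \<Rightarrow> complex" where
  "phi q x = (\<Prod>s. 1 - q ^ s * x)"

lemma phi_convergent:
  fixes q x :: complex
  assumes "norm q < 1"
  shows "convergent_prod (\<lambda>s. 1 - q ^ s * x)"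
proof -
  have "summable (\<lambda>s. norm (q ^ s * x))"
    unfolding norm_mult norm_power using assms by (intro summable_mult2 summable_geometric) simp
  then have "summable (\<lambda>s. norm (1 - q ^ s * x - 1))"
    by simp
  then show ?thesis
    by (intro abs_convergent_prod_imp_convergent_prod summable_imp_abs_convergent_prod)
qed

text \<open>\<open>theta q u\<close> is \<open>\<vartheta>(x)\<close> with \<open>x = e\<^sup>u\<close> and \<open>x\<^sup>1\<^sup>/\<^sup>2 = e\<^sup>u\<^sup>/\<^sup>2\<close>.\<close>

definition theta :: "complex \<Rightarrow> complex \<Rightarrow> complex" where
  "theta q u = (exp (u / 2) - exp (- (u / 2))) * phi q (q * exp u) * phi q (q / exp u)"

text \<open>
  A permutation \<open>I\<close> of \<open>{1..n}\<close> is a function with \<open>I permutes {1..n}\<close>, so that \<open>inv I\<close> is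
  its group inverse.  In \<open>perm_dot \<sigma> I\<close> the left factor acts on positions:
  \<open>\<sigma> \<cdot> I = (I\<^bsub>\<sigma>(1)\<^esub>, \<dots>, I\<^bsub>\<sigma>(n)\<^esub>)\<close>.
\<close>

definition perm_dot :: "(nat \<Rightarrow> nat) \<Rightarrow> (nat \<Rightarrow> nat) \<Rightarrow> (nat \<Rightarrow> nat)" where
  "perm_dot \<sigma> I = I \<circ> \<sigma>"

definition longest :: "nat \<Rightarrow> nat \<Rightarrow> nat" where
  "longest n k = (if k \<in> {1..n} then n + 1 - k else k)"

lemma longest_permutes: "longest n permutes {1..n}"
  by (rule bij_imp_permutes, rule bij_betw_byWitness[where f' = "longest n"])
     (auto simp: longest_def)

text \<open>\<open>ith I k a\<close> is \<open>i\<^sup>(\<^sup>k\<^sup>)\<^sub>a\<close>, the \<open>a\<close>-th smallest element of \<open>{I\<^sub>1, \<dots>, I\<^sub>k}\<close>.\<close>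

definition ith :: "(nat \<Rightarrow> nat) \<Rightarrow> nat \<Rightarrow> nat \<Rightarrow> nat" where
  "ith I k a = sorted_list_of_set (I ` {1..k}) ! (a - 1)"

definition p_ind :: "(nat \<Rightarrow> nat) \<Rightarrow> nat \<Rightarrow> nat \<Rightarrow> int" where
  "p_ind I j m = (if I j < m then 1 else 0)"

text \<open>Below, \<open>h\<close>, \<open>z\<close>, \<open>mu\<close>, \<open>t\<close> are the logarithms of \<open>\<hbar>\<close>, \<open>z\<^sub>i\<close>, \<open>\<mu>\<^sub>i\<close>,
  \<open>t\<^sup>(\<^sup>k\<^sup>)\<^sub>a\<close> (as \<open>t k a\<close>), and \<open>u\<close> is the logarithm of the argument \<open>x\<close> of \<open>\<psi>\<close>.\<close>

definition psi :: "complex \<Rightarrow> complex \<Rightarrow> (nat \<Rightarrow> nat) \<Rightarrow> (nat \<Rightarrow> complex)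
    \<Rightarrow> nat \<Rightarrow> nat \<Rightarrow> nat \<Rightarrow> complex \<Rightarrow> complex" where
  "psi q h I mu k a c u =
    (if ith I (k + 1) c < ith I k a then theta q (h + u)
     else if ith I (k + 1) c = ith I k a then
       theta q (u + of_int (1 - p_ind I (k + 1) (ith I k a)) * h
                  + mu (k + 1) - mu (inv I (ith I k a)))
     else theta q u)"

text \<open>The convention \<open>t\<^sup>(\<^sup>n\<^sup>)\<^sub>i = z\<^sub>i\<close>.\<close>

definition with_z :: "nat \<Rightarrow> (nat \<Rightarrow> nat \<Rightarrow> complex) \<Rightarrow> (nat \<Rightarrow> complex)
    \<Rightarrow> nat \<Rightarrow> nat \<Rightarrow> complex" where
  "with_z n t z = t(n := z)"

definition U_fun :: "nat \<Rightarrow> complex \<Rightarrow> complex \<Rightarrow> (nat \<Rightarrow> nat)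
    \<Rightarrow> (nat \<Rightarrow> complex) \<Rightarrow> (nat \<Rightarrow> complex) \<Rightarrow> (nat \<Rightarrow> nat \<Rightarrow> complex) \<Rightarrow> complex" where
  "U_fun n q h I z mu t =
    (\<Prod>k = 1..n - 1.
       (\<Prod>a = 1..k. \<Prod>c = 1..k + 1.
          psi q h I mu k a c (with_z n t z (k + 1) c - with_z n t z k a)) /
       (\<Prod>(a, b) \<in> {(a, b). 1 \<le> a \<and> a < b \<and> b \<le> k}.
          theta q (h + t k a - t k b) * theta q (t k b - t k a)))"

definition Sym :: "nat \<Rightarrow> ((nat \<Rightarrow> nat \<Rightarrow> complex) \<Rightarrow> complex)
    \<Rightarrow> (nat \<Rightarrow> nat \<Rightarrow> complex) \<Rightarrow> complex" where
  "Sym k F t = (\<Sum>p | p permutes {1..k}. F (t(k := t k \<circ> p)))"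

text \<open>\<open>Sym\<close> in \<open>t\<^sup>(\<^sup>1\<^sup>)\<close> is outermost and \<open>Sym\<close> in \<open>t\<^sup>(\<^sup>n\<^sup>-\<^sup>1\<^sup>)\<close> is innermost.\<close>

definition W_fun :: "nat \<Rightarrow> complex \<Rightarrow> complex \<Rightarrow> (nat \<Rightarrow> nat)
    \<Rightarrow> (nat \<Rightarrow> nat \<Rightarrow> complex) \<Rightarrow> (nat \<Rightarrow> complex) \<Rightarrow> (nat \<Rightarrow> complex) \<Rightarrow> complex" where
  "W_fun n q h I t z mu = foldr Sym [1..<n] (U_fun n q h I z mu) t"

definition z_subst :: "(nat \<Rightarrow> nat) \<Rightarrow> (nat \<Rightarrow> complex) \<Rightarrow> nat \<Rightarrow> nat \<Rightarrow> complex" where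
  "z_subst J z k a = z (ith J k a)"

definition A_mat :: "nat \<Rightarrow> complex \<Rightarrow> complex \<Rightarrow> (nat \<Rightarrow> nat) \<Rightarrow> (nat \<Rightarrow> nat)
    \<Rightarrow> (nat \<Rightarrow> complex) \<Rightarrow> (nat \<Rightarrow> complex) \<Rightarrow> complex" where
  "A_mat n q h I J z mu = W_fun n q h I (z_subst J z) z mu"

text \<open>
  As written, \<open>A\<^bsub>I,J\<^esub>\<close> is a finite sum of quotients, i.e. a meromorphic function of the
  logarithms.  \<open>A_defined n q h J z\<close> says that none of the denominators occurring in this sum
  (in any of the terms of the symmetrizations, hence for both orders of \<open>a\<close> and \<open>b\<close>) vanishes
  at the given point.  This excludes the points where HOL's convention \<open>x / 0 = 0\<close> would give
  meaningless values; the remaining points form a dense open set.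
\<close>

definition A_defined :: "nat \<Rightarrow> complex \<Rightarrow> complex \<Rightarrow> (nat \<Rightarrow> nat) \<Rightarrow> (nat \<Rightarrow> complex) \<Rightarrow> bool" where
  "A_defined n q h J z \<longleftrightarrow>
    (\<forall>k \<in> {1..n - 1}. \<forall>a \<in> {1..k}. \<forall>b \<in> {1..k}. a \<noteq> b \<longrightarrow>
       theta q (h + z_subst J z k a - z_subst J z k b) \<noteq> 0 \<and>
       theta q (z_subst J z k b - z_subst J z k a) \<noteq> 0)"

end

theory Submission
  imports Defs "HOL-Complex_Analysis.Complex_Analysis"
begin

text \<open>
  Exchanging \<open>z\<^sub>a\<close> and \<open>z\<^sub>a\<^sub>+\<^sub>1\<close> in a weight function gives a linear combination of \<open>W\<^sub>I\<close> and
  \<open>W\<close> for the permutation with the values \<open>a\<close> and \<open>a + 1\<close> of \<open>I\<close> exchanged (an R-matrix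
  relation). It follows by induction on the levels from the three-term identity of the theta
  function, and it determines all \<open>A\<^bsub>I,J\<^esub>\<close> from the \<open>A\<^bsub>I,\<sigma>\<^esub>\<close> with \<open>\<sigma>\<close> the longest permutation, which
  vanish for \<open>I \<noteq> \<sigma>\<close>. The right-hand side of the theorem satisfies the same relation if and only
  if \<open>A\<close> satisfies a dual relation exchanging \<open>\<mu>\<^sub>a\<close> and \<open>\<mu>\<^sub>a\<^sub>+\<^sub>1\<close>. The dual relation can be checked
  directly for \<open>J = \<sigma>\<close>, and it propagates to all \<open>J\<close> because the two relations commute. All this
  is done where no theta factor in a denominator vanishes; the other points are reached by continuity.
\<close>

section \<open>The theta function\<close>

text \<open>The obstacle is that z and mu enter differently: z through the symmetrizations, mu only
  through the factors with equal indices. So the two exchange relations need quite different proofs.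
  What makes the two sides comparable is that inversion turns composition with a transposition on
  the left (exchanging values) into composition on the right (exchanging positions). Composing mu
  with the longest permutation cancels the outer factor of \<open>longest n \<circ> inv I\<close>,
  and negating z matches the other difference, so both sides obey a recursion with identical
  coefficients. Its start needs two extreme cases, \<open>J\<close> longest and \<open>I\<close> the
  identity, in which at most one summand survives at each level. The sign arises there: reversing mu
  turns around n(n-1)/2 odd theta factors. Genericity serves not only the denominators: the
  recursion is divided by its coefficients, and the substituted values must be pairwise
  distinct.\<close>

lemma phi_holomorphic:
  assumes "norm q < 1"
  shows "phi q holomorphic_on UNIV"
proof (rule holomorphic_uniform_sequence[where f = "\<lambda>N x. \<Prod>s<N. 1 - q ^ s * x"])
  fix x :: complex
  have "uniformly_convergent_on (cball x 1) (\<lambda>N x. \<Sum>s<N. norm ((1 - q ^ s * x) - 1))"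
  proof (rule Weierstrass_m_test')
    show "norm (norm ((1 - q ^ n * y) - 1)) \<le> norm q ^ n * (norm x + 1)" if "y \<in> cball x 1" for n y
    proof -
      have "norm y \<le> norm x + norm (y - x)"
        by (metis add.commute diff_add_cancel norm_triangle_ineq)
      also have "norm (y - x) \<le> 1"
        using that by (simp add: dist_norm norm_minus_commute)
      finally show ?thesis
        by (simp add: norm_mult norm_power mult_left_mono)
    qed
    show "summable (\<lambda>n. norm q ^ n * (norm x + 1))"
      using assms by (intro summable_mult2 summable_geometric) simp
  qed
  then have "uniformly_convergent_on (cball x 1) (\<lambda>N x. \<Prod>s<N. 1 - q ^ s * x)"
    by (intro uniformly_convergent_on_prod') (auto intro!: continuous_intros)
  then obtain g where g: "uniform_limit (cball x 1) (\<lambda>N x. \<Prod>s<N. 1 - q ^ s * x) g sequentially"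
    by (auto simp: uniformly_convergent_on_def)
  have "g y = phi q y" if "y \<in> cball x 1" for y
  proof -
    have "(\<lambda>N. \<Prod>s<N. 1 - q ^ s * y) \<longlonglongrightarrow> g y"
      using tendsto_uniform_limitI[OF g that] .
    then have "(\<lambda>N. \<Prod>s<Suc N. 1 - q ^ s * y) \<longlonglongrightarrow> g y"
      by (rule LIMSEQ_Suc)
    then have "(\<lambda>N. \<Prod>s\<le>N. 1 - q ^ s * y) \<longlonglongrightarrow> g y"
      by (simp add: lessThan_Suc_atMost)
    moreover have "(\<lambda>N. \<Prod>s\<le>N. 1 - q ^ s * y) \<longlonglongrightarrow> phi q y"
      unfolding phi_def by (rule convergent_prod_LIMSEQ[OF phi_convergent[OF assms]])
    ultimately show ?thesis
      by (rule LIMSEQ_unique)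
  qed
  with g have "uniform_limit (cball x 1) (\<lambda>N x. \<Prod>s<N. 1 - q ^ s * x) (phi q) sequentially"
    by (subst uniform_limit_cong'[symmetric, where f = "\<lambda>N x. \<Prod>s<N. 1 - q ^ s * x" and h = g]) auto
  then show "\<exists>d>0. cball x d \<subseteq> UNIV \<and>
      uniform_limit (cball x d) (\<lambda>N x. \<Prod>s<N. 1 - q ^ s * x) (phi q) sequentially"
    by (intro exI[of _ 1]) auto
qed (auto intro!: holomorphic_intros)

lemma phi_rec:
  assumes "norm q < 1"
  shows "phi q x = (1 - x) * phi q (q * x)"
proof (cases "x = 1")
  case True
  have "phi q x = 0"
    unfolding phi_def
    by (rule has_prod_zeroI[OF convergent_prod_has_prod[OF phi_convergent[OF assms]], where n = 0])
      (use True in simp)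
  then show ?thesis
    using True by simp
next
  case False
  then show ?thesis
    using prodinf_split_head[OF phi_convergent[OF assms], of x]
    by (simp add: phi_def mult.assoc[symmetric] mult.commute)
qed

lemma phi_nonzero:
  assumes "norm q < 1" "\<And>s. q ^ s * x \<noteq> 1"
  shows "phi q x \<noteq> 0"
  unfolding phi_def using assms by (intro prodinf_nonzero phi_convergent) (auto simp: algebra_simps)

locale nome =
  fixes q :: complex
  assumes q_nz: "q \<noteq> 0" and q_less: "norm q < 1"
begin

abbreviation th :: "complex \<Rightarrow> complex" where
  "th \<equiv> theta q"

lemma th_holomorphic: "th holomorphic_on UNIV"
proof -
  have phi: "(\<lambda>u. phi q (f u)) holomorphic_on UNIV" if "f holomorphic_on UNIV" for f
    using holomorphic_on_compose_gen[OF that phi_holomorphic[OF q_less]] by (simp add: o_def)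
  show ?thesis
    unfolding theta_def by (intro holomorphic_intros phi) auto
qed

lemmas th_holomorphic_on [holomorphic_intros] =
  holomorphic_on_compose_gen[OF _ th_holomorphic subset_UNIV, unfolded o_def]

lemma th_continuous: "continuous_on UNIV th"
  by (rule holomorphic_on_imp_continuous_on[OF th_holomorphic])

lemmas th_continuous_on [continuous_intros] =
  continuous_on_compose2[OF th_continuous _ subset_UNIV]

lemma th_minus: "th (- u) = - th u"
  by (simp add: theta_def exp_minus field_simps)

lemma th_diff: "th (u - v) = - th (v - u)"
  using th_minus[of "v - u"] by simp

lemma th_0 [simp]: "th 0 = 0"
  by (simp add: theta_def)

text \<open>The factor 1 - 1/x is absorbed into the second product by \<open>phi_rec\<close>. In
  this form a nowhere vanishing exponential is multiplied by two infinite products, from which both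
  shifts and all zeros can be read off.\<close>

lemma th_alt: "th u = exp (u / 2) * phi q (q * exp u) * phi q (exp (- u))"
proof -
  have "exp (u / 2) * exp (- u) = exp (u / 2 + - u)"
    by (rule exp_add[symmetric])
  also have "u / 2 + - u = - (u / 2)"
    by simp
  finally have "exp (u / 2) - exp (- (u / 2)) = exp (u / 2) * (1 - exp (- u))"
    by (simp add: right_diff_distrib)
  moreover have "phi q (exp (- u)) = (1 - exp (- u)) * phi q (q / exp u)"
    using phi_rec[OF q_less, of "exp (- u)"] by (simp add: exp_minus divide_inverse)
  ultimately show ?thesis
    unfolding theta_def by simp
qed

section \<open>Quasi-periodicity, zeros, and division by theta\<close>

lemma th_plus_2pi_i: "th (u + 2 * of_real pi * \<i>) = - th u"
proof -
  have "exp ((u + 2 * of_real pi * \<i>) / 2) = - exp (u / 2)"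
    by (simp add: add_divide_distrib exp_add)
  moreover have "exp (- (u + 2 * of_real pi * \<i>)) = exp (- u)" "exp (u + 2 * of_real pi * \<i>) = exp u"
    by (simp_all only: exp_minus exp_add exp_two_pi_i mult_1_right)
  ultimately show ?thesis
    by (simp only: th_alt) simp
qed

lemma th_plus_Ln_q: "th (u + Ln q) = - exp (- (Ln q / 2) - u) * th u"
proof -
  have eq: "exp (Ln q) = q"
    using q_nz by simp
  have "exp (- (u + Ln q)) = 1 / (q * exp u)"
    by (simp only: exp_minus exp_add eq) (simp add: divide_inverse mult.commute)
  moreover from this have "q * exp (- (u + Ln q)) = exp (- u)"
    using q_nz by (simp add: exp_minus inverse_eq_divide)
  ultimately have 1: "phi q (exp (- (u + Ln q))) = (1 - 1 / (q * exp u)) * phi q (exp (- u))"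
    using phi_rec[OF q_less, of "exp (- (u + Ln q))"] by simp
  have 2: "phi q (q * exp u) = (1 - q * exp u) * phi q (q * exp (u + Ln q))"
    using phi_rec[OF q_less, of "q * exp u"] by (simp add: exp_add eq mult_ac)
  have 3: "exp ((u + Ln q) / 2) = exp (- (Ln q / 2) - u) * exp (u / 2) * (q * exp u)"
  proof -
    have "exp (- (Ln q / 2) - u) * exp (u / 2) * (exp (Ln q) * exp u) = exp ((u + Ln q) / 2)"
      by (simp flip: exp_add) (simp add: field_simps)
    then show ?thesis
      by (simp add: eq)
  qed
  have "th (u + Ln q) = exp (- (Ln q / 2) - u) * exp (u / 2) * phi q (q * exp (u + Ln q)) *
      ((q * exp u) * (1 - 1 / (q * exp u))) * phi q (exp (- u))"
    unfolding th_alt[of "u + Ln q"] 1 3 by (simp only: mult_ac)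
  also have "(q * exp u) * (1 - 1 / (q * exp u)) = - (1 - q * exp u)"
    using q_nz by (simp add: field_simps)
  finally show ?thesis
    unfolding th_alt[of u] 2 by (simp only: mult_ac mult_minus_left mult_minus_right)
qed

text \<open>Shifts of this kind form a group, and every zero of theta turns out to be one of them.
  Hence the behaviour at an arbitrary zero is that at 0, up to a nonvanishing factor.\<close>

definition quasi_period :: "complex \<Rightarrow> bool" where
  "quasi_period \<omega> \<longleftrightarrow> (\<exists>\<alpha> \<beta>. \<forall>u. th (u + \<omega>) = exp (\<alpha> * u + \<beta>) * th u)"

lemma quasi_period_add:
  assumes "quasi_period \<omega>" "quasi_period \<omega>'"
  shows "quasi_period (\<omega> + \<omega>')"
proof -
  obtain a b c d where "\<And>u. th (u + \<omega>) = exp (a * u + b) * th u"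
      "\<And>u. th (u + \<omega>') = exp (c * u + d) * th u"
    using assms unfolding quasi_period_def by metis
  then have "th (u + \<omega> + \<omega>') = exp (c * (u + \<omega>) + d) * (exp (a * u + b) * th u)" for u
    by simp
  also have "exp (c * (u + \<omega>) + d) * (exp (a * u + b) * th u) =
      exp ((a + c) * u + (b + d + c * \<omega>)) * th u" for u
  proof -
    have "(c * (u + \<omega>) + d) + (a * u + b) = (a + c) * u + (b + d + c * \<omega>)"
      by (simp add: algebra_simps)
    then show ?thesis
      by (metis exp_add mult.assoc)
  qed
  finally have "th (u + (\<omega> + \<omega>')) = exp ((a + c) * u + (b + d + c * \<omega>)) * th u" for u
    by (simp add: add.assoc)
  then show ?thesis
    unfolding quasi_period_def by blast
qed

lemma quasi_period_minus:
  assumes "quasi_period \<omega>"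
  shows "quasi_period (- \<omega>)"
proof -
  obtain a b where ab: "\<And>u. th (u + \<omega>) = exp (a * u + b) * th u"
    using assms unfolding quasi_period_def by metis
  have "th (u + - \<omega>) = exp (- a * u + (a * \<omega> - b)) * th u" for u
  proof -
    have "th u = exp (a * (u - \<omega>) + b) * th (u + - \<omega>)"
      using ab[of "u - \<omega>"] by simp
    moreover have "- a * u + (a * \<omega> - b) = - (a * (u - \<omega>) + b)"
      by (simp add: algebra_simps)
    ultimately show ?thesis
      by (simp only: exp_minus) simp
  qed
  then show ?thesis
    unfolding quasi_period_def by blast
qed

lemma quasi_period_of_int:
  assumes "quasi_period \<omega>"
  shows "quasi_period (of_int k * \<omega>)"
proof -
  have 0: "quasi_period 0"
    unfolding quasi_period_def by (rule exI[of _ 0], rule exI[of _ 0]) simp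
  show ?thesis
  proof (induction k rule: int_induct[where k = 0])
    case (step1 i)
    then show ?case
      using quasi_period_add[OF _ assms] by (simp add: distrib_right add.commute[of \<omega>])
  next
    case (step2 i)
    then show ?case
      using quasi_period_add[OF _ quasi_period_minus[OF assms]] by (simp add: left_diff_distrib)
  qed (use 0 in simp)
qed

lemma quasi_period_generators: "quasi_period (2 * of_real pi * \<i>)" "quasi_period (Ln q)"
proof -
  have "th (u + 2 * of_real pi * \<i>) = exp (0 * u + of_real pi * \<i>) * th u" for u
    by (simp add: th_plus_2pi_i)
  then show "quasi_period (2 * of_real pi * \<i>)"
    unfolding quasi_period_def by blast
  have "th (u + Ln q) = exp (- 1 * u + (of_real pi * \<i> - Ln q / 2)) * th u" for u
  proof -
    have "- 1 * u + (of_real pi * \<i> - Ln q / 2) = of_real pi * \<i> + (- (Ln q / 2) - u)"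
      by simp
    then show ?thesis
      unfolding th_plus_Ln_q by (simp only: exp_add exp_pi_i) simp
  qed
  then show "quasi_period (Ln q)"
    unfolding quasi_period_def by blast
qed

text \<open>A zero of one of the two products forces exp u to be an integer power of q. Taking
  logarithms puts u into the lattice spanned by \<open>Ln q\<close> and 2 pi i, whose generators are
  quasi-periods.\<close>

lemma th_zero_quasi_period:
  assumes "th u = 0"
  shows "quasi_period u"
proof -
  have lattice: "quasi_period u" if "exp u = exp (of_int k * Ln q)" for k
  proof -
    obtain m where "u = of_int k * Ln q + of_real (real_of_int (2 * m) * pi) * \<i>"
      using \<open>exp u = _\<close> unfolding exp_eq by blast
    then have "u = of_int k * Ln q + of_int m * (2 * of_real pi * \<i>)"
      by (simp add: mult_ac)
    then show ?thesis
      by (simp add: quasi_period_add quasi_period_of_int quasi_period_generators)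
  qed
  have pow: "exp (of_int (int s) * Ln q) = q ^ s" for s
    using q_nz by (simp add: exp_of_nat_mult)
  have "phi q (q * exp u) = 0 \<or> phi q (exp (- u)) = 0"
    using assms by (simp add: th_alt)
  then consider s where "q ^ s * (q * exp u) = 1" | s where "q ^ s * exp (- u) = 1"
    using phi_nonzero[OF q_less] by blast
  then show ?thesis
  proof cases
    case 1
    have "exp (of_int (- int (Suc s)) * Ln q) = inverse (q ^ Suc s)"
      by (simp only: of_int_minus mult_minus_left exp_minus pow)
    also have "\<dots> = exp u"
      using 1 by (intro inverse_unique) (simp add: mult_ac)
    finally show ?thesis
      by (rule lattice[OF sym])
  next
    case 2
    then have "exp u = exp (of_int (int s) * Ln q)"
      by (simp only: pow) (simp add: exp_minus field_simps)
    then show ?thesis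
      by (rule lattice)
  qed
qed

lemma phi_q_nonzero: "phi q q \<noteq> 0"
proof (rule phi_nonzero[OF q_less])
  fix s
  have "norm q ^ s * norm q \<le> 1 * norm q"
    using q_less by (intro mult_right_mono power_le_one) auto
  then have "norm (q ^ s * q) < 1"
    using q_less by (simp add: norm_mult norm_power)
  then show "q ^ s * q \<noteq> 1"
    by auto
qed

text \<open>The first factor vanishes at 0 with derivative 1, so the derivative is the value
  phi(q)^2 of the remaining product.\<close>

lemma deriv_th_0: "deriv th 0 \<noteq> 0"
proof -
  have 1: "((\<lambda>u. exp (u / 2) - exp (- (u / 2))) has_field_derivative 1) (at (0::complex))"
    by (auto intro!: derivative_eq_intros)
  define g where "g = (\<lambda>u. phi q (q * exp u) * phi q (q / exp u))"
  have "g holomorphic_on UNIV"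
  proof -
    have phi: "(\<lambda>u. phi q (f u)) holomorphic_on UNIV" if "f holomorphic_on UNIV" for f
      using holomorphic_on_compose_gen[OF that phi_holomorphic[OF q_less]] by (simp add: o_def)
    show ?thesis
      unfolding g_def by (intro holomorphic_intros phi) auto
  qed
  then have "(g has_field_derivative deriv g 0) (at 0)"
    by (intro holomorphic_derivI[of _ UNIV]) auto
  from DERIV_mult[OF 1 this] have "(th has_field_derivative g 0) (at 0)"
    by (simp add: theta_def[abs_def] g_def mult.assoc)
  then show ?thesis
    using phi_q_nonzero by (simp add: DERIV_imp_deriv g_def)
qed

text \<open>All zeros are simple: each is a quasi-period, and differentiating the shift formula at 0
  transports \<open>deriv_th_0\<close>.\<close>

lemma deriv_th_zero:
  assumes "th p = 0"
  shows "deriv th p \<noteq> 0"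
proof -
  obtain a b where ab: "\<And>u. th (u + p) = exp (a * u + b) * th u"
    using th_zero_quasi_period[OF assms] unfolding quasi_period_def by metis
  have d: "(th has_field_derivative deriv th u) (at u)" for u
    by (intro holomorphic_derivI[OF th_holomorphic]) auto
  have "((\<lambda>u. th (u + p)) has_field_derivative deriv th p) (at 0)"
    using d[of p] DERIV_shift[of th "deriv th p" 0 p] by simp
  moreover have "((\<lambda>u. exp (a * u + b) * th u) has_field_derivative exp b * deriv th 0) (at 0)"
    by (auto intro!: derivative_eq_intros d)
  ultimately have "deriv th p = exp b * deriv th 0"
    unfolding ab by (rule DERIV_unique)
  then show ?thesis
    using deriv_th_0 by simp
qed

text \<open>The zeros of theta are simple, so a function vanishing at all of them has a quotient
  with removable singularities only.\<close>

lemma th_divide: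
  assumes F: "F holomorphic_on UNIV" and zero: "\<And>u. th u = 0 \<Longrightarrow> F u = 0"
  shows "\<exists>G. G holomorphic_on UNIV \<and> (\<forall>u. F u = G u * th u)"
proof -
  define G where "G = (\<lambda>u. if th u = 0 then deriv F u / deriv th u else F u / th u)"
  have G: "F u = G u * th u" for u
    by (simp add: G_def zero)
  have "G field_differentiable (at p)" for p
  proof (cases "th p = 0")
    case False
    have "open {u. th u \<noteq> 0}"
      using open_Collect_neq[OF th_continuous continuous_on_const[of UNIV 0]] by simp
    moreover have "(\<lambda>u. F u / th u) holomorphic_on {u. th u \<noteq> 0}"
      using F th_holomorphic by (intro holomorphic_on_divide) (auto intro: holomorphic_on_subset)
    then have "G holomorphic_on {u. th u \<noteq> 0}"
      by (rule holomorphic_transform) (auto simp: G_def)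
    ultimately show ?thesis
      using False by (intro holomorphic_on_imp_differentiable_at) auto
  next
    case True
    \<comment> \<open>Near the zero p the quotient equals \<open>A / B\<close>, the quotient of the
      two difference quotients. These are holomorphic, and \<open>B p\<close> is the nonzero
      derivative of theta.\<close>
    define A where "A = (\<lambda>z. if z = p then deriv F p else (F z - F p) / (z - p))"
    define B where "B = (\<lambda>z. if z = p then deriv th p else (th z - th p) / (z - p))"
    have hol: "A holomorphic_on UNIV" "B holomorphic_on UNIV"
      unfolding A_def B_def by (intro pole_lemma_open F th_holomorphic open_UNIV)+
    have "open {u. B u \<noteq> 0}"
      using open_Collect_neq[OF holomorphic_on_imp_continuous_on[OF hol(2)] continuous_on_const[of UNIV 0]]
      by simp
    moreover have "p \<in> {u. B u \<noteq> 0}"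
      using deriv_th_zero[OF True] by (simp add: B_def)
    moreover have "(\<lambda>u. A u / B u) holomorphic_on {u. B u \<noteq> 0}"
      using hol by (intro holomorphic_on_divide) (auto intro: holomorphic_on_subset)
    then have "G holomorphic_on {u. B u \<noteq> 0}"
      by (rule holomorphic_transform)
        (use True zero in \<open>auto simp: G_def A_def B_def split: if_splits\<close>)
    ultimately show ?thesis
      by (intro holomorphic_on_imp_differentiable_at)
  qed
  then have "G holomorphic_on UNIV"
    by (simp add: holomorphic_on_def field_differentiable_at_within)
  with G show ?thesis
    by blast
qed

lemma countable_th_zeros: "countable {u. th u = 0}"
proof -
  have "\<not> th constant_on UNIV"
  proof
    assume "th constant_on UNIV"
    then have "th = (\<lambda>_. th 0)"
      unfolding constant_on_def by (metis UNIV_I)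
    then have "deriv th 0 = deriv (\<lambda>_. th 0) 0"
      by (rule arg_cong)
    then show False
      using deriv_th_0 by simp
  qed
  then show ?thesis
    using holomorphic_countable_zeros[OF th_holomorphic open_UNIV connected_UNIV]
    by (simp add: fsigma.intros[of "\<lambda>_. UNIV", simplified])
qed

lemma countable_th_affine_zeros:
  assumes "m \<noteq> 0"
  shows "countable {x. th (m * x + c) = 0}"
proof -
  have "{x. th (m * x + c) = 0} \<subseteq> (\<lambda>u. (u - c) / m) ` {u. th u = 0}"
  proof
    fix x assume "x \<in> {x. th (m * x + c) = 0}"
    then show "x \<in> (\<lambda>u. (u - c) / m) ` {u. th u = 0}"
      using assms by (intro image_eqI[where x = "m * x + c"]) auto
  qed
  then show ?thesis
    using countable_th_zeros by (meson countable_image countable_subset)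
qed

text \<open>A nonempty open set is uncountable, so it cannot be contained in the exceptional set.
  This removes genericity assumptions from identities between theta functions.\<close>

lemma continuous_eq_0_if_cocountable:
  fixes f :: "complex \<Rightarrow> complex"
  assumes f: "continuous_on UNIV f" and S: "countable S" and eq: "\<And>x. x \<notin> S \<Longrightarrow> f x = 0"
  shows "f x = 0"
proof (rule ccontr)
  assume "f x \<noteq> 0"
  have "open {y. f y \<noteq> 0}"
    using open_Collect_neq[OF f continuous_on_const[of UNIV 0]] by simp
  then obtain e where "e > 0" "ball x e \<subseteq> {y. f y \<noteq> 0}"
    using \<open>f x \<noteq> 0\<close> by (auto elim: openE)
  then have "uncountable {y. f y \<noteq> 0}"
    using uncountable_ball countable_subset by blast
  moreover have "{y. f y \<noteq> 0} \<subseteq> S"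
    using eq by blast
  ultimately show False
    using S countable_subset by blast
qed

section \<open>Elliptic functions without poles, and the three-term identity\<close>

lemma periodic_of_int:
  fixes G :: "complex \<Rightarrow> complex"
  assumes "\<And>u. G (u + \<omega>) = G u"
  shows "G (u + of_int k * \<omega>) = G u"
proof (induction k arbitrary: u rule: int_induct[where k = 0])
  case (step1 i)
  have "G (u + of_int (i + 1) * \<omega>) = G (u + of_int i * \<omega> + \<omega>)"
    by (simp add: algebra_simps)
  then show ?case
    using step1 assms by simp
next
  case (step2 i)
  have "G (u + of_int (i - 1) * \<omega>) = G (u + of_int (i - 1) * \<omega> + \<omega>)"
    using assms by simp
  also have "u + of_int (i - 1) * \<omega> + \<omega> = u + of_int i * \<omega>"
    by (simp add: algebra_simps)
  finally show ?case
    using step2 by simp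
qed simp

text \<open>Every value is already taken on a compact rectangle, so the function is bounded and
  Liouville's theorem applies.\<close>

lemma elliptic_constant:
  assumes G: "G holomorphic_on UNIV"
    and per: "\<And>u. G (u + 2 * of_real pi * \<i>) = G u" "\<And>u. G (u + Ln q) = G u"
  shows "G u = G v"
proof -
  define r where "r = Re (Ln q)"
  have r: "r < 0"
    using q_nz q_less by (simp add: r_def)
  define K where "K = cbox (Complex r 0) (Complex 0 (2 * pi))"
  have "\<exists>y\<in>K. G x = G y" for x
  proof -
    \<comment> \<open>The order of the two reductions matters: \<open>Ln q\<close> may have an
      imaginary part, but the later shift by multiples of 2 pi i keeps the real part already
      reached.\<close>
    define k where "k = \<lfloor>Re x / r\<rfloor>"
    define y where "y = x + of_int (- k) * Ln q"
    define m where "m = \<lfloor>Im y / (2 * pi)\<rfloor>"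
    define w where "w = y + of_int (- m) * (2 * of_real pi * \<i>)"
    have "Re w = r * (Re x / r - of_int k)"
      using r by (simp add: w_def y_def r_def algebra_simps)
    moreover have "0 \<le> Re x / r - of_int k" "Re x / r - of_int k \<le> 1"
      unfolding k_def by linarith+
    ultimately have Re: "r \<le> Re w" "Re w \<le> 0"
      using r mult_left_mono_neg[of "Re x / r - of_int k" 1 r]
      by (auto intro: mult_nonpos_nonneg)
    have "Im w = 2 * pi * (Im y / (2 * pi) - of_int m)"
      by (simp add: w_def algebra_simps)
    moreover have "0 \<le> Im y / (2 * pi) - of_int m" "Im y / (2 * pi) - of_int m \<le> 1"
      unfolding m_def by linarith+
    ultimately have Im: "0 \<le> Im w" "Im w \<le> 2 * pi"
      using mult_left_mono[of "Im y / (2 * pi) - of_int m" 1 "2 * pi"] by auto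
    have "w \<in> K"
      using Re Im by (simp add: K_def in_cbox_complex_iff)
    moreover have "G w = G x"
      unfolding w_def y_def by (simp only: periodic_of_int[of G, OF per(1)] periodic_of_int[of G, OF per(2)])
    ultimately show ?thesis
      by (intro bexI[of _ w]) auto
  qed
  then have "range G \<subseteq> G ` K"
    by blast
  moreover have "compact (G ` K)"
    unfolding K_def using holomorphic_on_imp_continuous_on[OF G]
    by (intro compact_continuous_image) (auto intro: continuous_on_subset)
  ultimately have "bounded (range G)"
    using bounded_subset compact_imp_bounded by blast
  then have "G constant_on UNIV"
    by (rule Liouville_theorem[OF G])
  then show ?thesis
    unfolding constant_on_def by (metis UNIV_I)
qed

lemma holomorphic_shift:
  assumes "f holomorphic_on UNIV"
  shows "(\<lambda>u. f (u + c)) holomorphic_on UNIV"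
proof -
  have "(f \<circ> (\<lambda>u. u + c)) holomorphic_on UNIV"
    by (rule holomorphic_on_compose_gen[OF _ assms subset_UNIV]) (intro holomorphic_intros)
  then show ?thesis
    by (simp add: o_def)
qed

text \<open>The multiplier does not depend on \<open>a\<close>. Therefore the three terms of the
  three-term identity, as functions of u, are all multiplied by the same exponential.\<close>

lemma th_pair_shift:
  assumes "\<And>u. th (u + \<omega>) = exp (\<alpha> * u + \<beta>) * th u"
  shows "th (u + \<omega> + a) * th (u + \<omega> - a) = exp (2 * \<alpha> * u + 2 * \<beta>) * (th (u + a) * th (u - a))"
proof -
  have "th (u + \<omega> + a) = exp (\<alpha> * (u + a) + \<beta>) * th (u + a)"
      "th (u + \<omega> - a) = exp (\<alpha> * (u - a) + \<beta>) * th (u - a)"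
    using assms[of "u + a"] assms[of "u - a"] by (simp_all add: algebra_simps)
  moreover have E: "exp (2 * \<alpha> * u + 2 * \<beta>) = exp (\<alpha> * (u + a) + \<beta>) * exp (\<alpha> * (u - a) + \<beta>)"
    unfolding mult_exp_exp by (rule arg_cong[where f = exp]) (simp add: algebra_simps)
  ultimately show ?thesis
    by (simp only: E mult_ac)
qed

text \<open>As a function of u the left side \<open>F\<close> vanishes at b and -b, which are
  distinct modulo the zeros of theta because \<open>th (b + b)\<close> is nonzero. Hence
  \<open>F\<close> is divisible by th(u + b) th(u - b), the quotient is elliptic and so constant,
  and the further zero c of \<open>F\<close> shows that the constant is 0.\<close>

lemma th_three_term_generic:
  assumes nz: "th (b + b) \<noteq> 0" "th (b + c) \<noteq> 0" "th (b - c) \<noteq> 0"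
  shows "th (u + a) * th (u - a) * (th (b + c) * th (b - c)) +
    th (u + b) * th (u - b) * (th (c + a) * th (c - a)) +
    th (u + c) * th (u - c) * (th (a + b) * th (a - b)) = 0"
proof -
  define F where "F u = th (u + a) * th (u - a) * (th (b + c) * th (b - c)) +
    th (u + b) * th (u - b) * (th (c + a) * th (c - a)) +
    th (u + c) * th (u - c) * (th (a + b) * th (a - b))" for u
  have F_hol: "F holomorphic_on UNIV"
    unfolding F_def by (intro holomorphic_intros)
  have F_shift: "F (u + \<omega>) = exp (2 * \<alpha> * u + 2 * \<beta>) * F u"
    if "\<And>u. th (u + \<omega>) = exp (\<alpha> * u + \<beta>) * th u" for \<omega> \<alpha> \<beta> u
    unfolding F_def by (simp only: th_pair_shift[OF that]) (simp only: distrib_left mult_ac)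
  have F_zero: "F (u + \<omega>) = 0" if zero: "th \<omega> = 0" "F u = 0" for u \<omega>
  proof -
    obtain \<alpha> \<beta> where "\<And>v. th (v + \<omega>) = exp (\<alpha> * v + \<beta>) * th v"
      using th_zero_quasi_period[OF zero(1)] unfolding quasi_period_def by metis
    from F_shift[OF this] show ?thesis
      using zero(2) by simp
  qed
  have "F b = 0"
    unfolding F_def using th_diff[of b a] by (simp add: add.commute)
  moreover have "F (- u) = F u" for u
  proof -
    have "th (- u + x) * th (- u - x) = th (u + x) * th (u - x)" for x
    proof -
      have "th (- u + x) = - th (u - x)" "th (- u - x) = - th (u + x)"
        using th_minus[of "u - x"] th_minus[of "u + x"] by simp_all
      then show ?thesis
        by simp
    qed
    then show ?thesis
      unfolding F_def by simp
  qed
  ultimately have "F (- b) = 0"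
    by simp
  have "F c = 0"
    unfolding F_def using th_diff[of b c] th_diff[of c a] by (simp add: add.commute)
  have "(\<lambda>u. F (u + b)) holomorphic_on UNIV"
    by (rule holomorphic_shift[OF F_hol])
  moreover have "F (u + b) = 0" if "th u = 0" for u
    using F_zero[OF that \<open>F b = 0\<close>] by (simp add: add.commute)
  ultimately obtain G1 where G1: "G1 holomorphic_on UNIV" "\<And>u. F (u + b) = G1 u * th u"
    using th_divide[of "\<lambda>u. F (u + b)"] by blast
  have "(\<lambda>u. G1 (u - (b + b))) holomorphic_on UNIV"
    using holomorphic_shift[OF G1(1), of "- (b + b)"] by simp
  moreover have "G1 (u - (b + b)) = 0" if u: "th u = 0" for u
  proof -
    have "F (u - b) = 0"
      using F_zero[OF u \<open>F (- b) = 0\<close>] by (simp add: add.commute)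
    then have "G1 (u - (b + b)) * th (u - (b + b)) = 0"
      using G1(2)[of "u - (b + b)"] by (simp add: algebra_simps)
    moreover obtain \<alpha> \<beta> where "\<And>v. th (v + u) = exp (\<alpha> * v + \<beta>) * th v"
      using th_zero_quasi_period[OF u] unfolding quasi_period_def by metis
    from this[of "- (b + b)"] have "th (u - (b + b)) \<noteq> 0"
      using nz(1) th_minus[of "b + b"] by (simp add: add.commute)
    ultimately show ?thesis
      by simp
  qed
  ultimately obtain G2 where G2: "G2 holomorphic_on UNIV" "\<And>u. G1 (u - (b + b)) = G2 u * th u"
    using th_divide[of "\<lambda>u. G1 (u - (b + b))"] by blast
  define G where "G u = G2 (u + b)" for u
  have G_hol: "G holomorphic_on UNIV"
    unfolding G_def by (rule holomorphic_shift[OF G2(1)])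
  have FG: "F u = G u * (th (u + b) * th (u - b))" for u
    using G1(2)[of "u - b"] G2(2)[of "u + b"] by (simp add: G_def algebra_simps)
  have per: "G (u + \<omega>) = G u" if period: "quasi_period \<omega>" for u \<omega>
  proof -
    obtain \<alpha> \<beta> where \<omega>: "\<And>v. th (v + \<omega>) = exp (\<alpha> * v + \<beta>) * th v"
      using period unfolding quasi_period_def by metis
    have eq: "G (v + \<omega>) - G v = 0" if v: "v \<notin> {v. th (1 * v + b) = 0} \<union> {v. th (1 * v + (- b)) = 0}" for v
    proof -
      have "G (v + \<omega>) * (exp (2 * \<alpha> * v + 2 * \<beta>) * (th (v + b) * th (v - b))) =
          exp (2 * \<alpha> * v + 2 * \<beta>) * (G v * (th (v + b) * th (v - b)))"
        using F_shift[OF \<omega>, of v] unfolding FG th_pair_shift[OF \<omega>] .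
      then show ?thesis
        using v by simp
    qed
    have cont: "continuous_on UNIV (\<lambda>v. G (v + \<omega>) - G v)"
      by (intro holomorphic_on_imp_continuous_on holomorphic_on_diff holomorphic_shift G_hol)
    have "countable ({v. th (1 * v + b) = 0} \<union> {v. th (1 * v + (- b)) = 0})"
      by (intro countable_Un countable_th_affine_zeros) auto
    from continuous_eq_0_if_cocountable[OF cont this eq] show ?thesis
      by simp
  qed
  have "G c = 0"
    using FG[of c] \<open>F c = 0\<close> nz th_diff[of b c] by (simp add: add.commute)
  then have "G u = 0"
    using elliptic_constant[OF G_hol per per, OF quasi_period_generators, of u c] by simp
  then show ?thesis
    using FG[of u] by (simp add: F_def)
qed

lemma th_three_term:
  "th (u + a) * th (u - a) * (th (b + c) * th (b - c)) +
    th (u + b) * th (u - b) * (th (c + a) * th (c - a)) +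
    th (u + c) * th (u - c) * (th (a + b) * th (a - b)) = 0"
proof (rule continuous_eq_0_if_cocountable[of "\<lambda>b.
    th (u + a) * th (u - a) * (th (b + c) * th (b - c)) +
    th (u + b) * th (u - b) * (th (c + a) * th (c - a)) +
    th (u + c) * th (u - c) * (th (a + b) * th (a - b))"])
  show "countable ({b. th (2 * b + 0) = 0} \<union> {b. th (1 * b + c) = 0} \<union> {b. th (1 * b + (- c)) = 0})"
    by (intro countable_Un countable_th_affine_zeros) auto
qed (use th_three_term_generic[of _ c u a] in \<open>auto intro!: continuous_intros\<close>)

section \<open>Local exchange identities\<close>

text \<open>This is the exchange relation in its simplest instance, with one lower variable: s and
  s' trade places, and the coefficients are already those of the relation for the weight
  functions.\<close>

lemma th_three_term':
  "th l * th (h + s - s') * (th (s' + h + l) * th s) =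
    th h * th (l - s + s') * (th (s + h + l) * th s') +
    th (h + l) * th (s - s') * (th (h + s) * th (s' + l))"
proof -
  \<comment> \<open>The half-sums are found by solving for the arguments: the sums and differences
    of u, a, b, c have to be, up to sign, the twelve arguments in the statement.\<close>
  define u a b c where "u = h + (s + l) / 2" and "a = (s + l) / 2"
    and "b = s' + (l - s) / 2" and "c = (s - l) / 2"
  have args: "u + a = s + h + l" "u - a = h" "b + c = s'" "b - c = - (s - l - s')"
      "u + b = s' + h + l" "u - b = h + s - s'" "c + a = s" "c - a = - l"
      "u + c = h + s" "u - c = h + l" "a + b = s' + l" "a - b = s - s'"
    unfolding u_def a_def b_def c_def by (simp_all add: field_simps)
  have "th (- (s - l - s')) = th (l - s + s')"
    by (simp add: algebra_simps)
  then show ?thesis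
    using th_three_term[of u a b c] unfolding args th_minus[of l] by (simp add: algebra_simps)
qed

lemma th_unitarity:
  "th l ^ 2 * (th (h + x) * th (h - x)) =
    th h ^ 2 * (th (l - x) * th (l + x)) + th (h + l) * th (h - l) * th x ^ 2"
proof -
  have "th (- l - x) = - th (l + x)"
    using th_minus[of "l + x"] by simp
  then show ?thesis
    using th_three_term'[of l h "- l" "- l - x"] th_minus[of l] th_minus[of x]
    by (simp add: power2_eq_square algebra_simps)
qed

text \<open>The part of a level numerator with both indices in {a, a + 1}: y, y' are the lower
  variables, x, x' the upper ones, and m, m' the shifts in the two factors with equal
  indices.\<close>

definition block :: "complex \<Rightarrow> complex \<Rightarrow> complex \<Rightarrow> complex \<Rightarrow> complex \<Rightarrow> complex \<Rightarrow> complex \<Rightarrow> complex" where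
  "block h m m' y y' x x' = th (x - y + m) * th (x' - y) * th (h + x - y') * th (x' - y' + m')"

text \<open>Up to the factor \<open>th (h + (m - m'))\<close> this compares the coefficients of
  \<open>v\<close> in \<open>block_exchange\<close> once \<open>ws\<close> and \<open>vs\<close> are
  eliminated. The two three-term identities used share the factor \<open>th (X + Y)\<close>, through
  which they are chained.\<close>

lemma block_exchange_offdiag:
  "th (m - m') * th (h + (x - x')) * th (y - y') * block h m m' y' y x' x =
    th h * th (m - m' - (x - x')) * th (y - y') * block h m m' y' y x x' +
    th (x - x') * (th h * th (m - m' + (y - y')) * block h m' m y' y x x'
      - th (m - m') * th (h - (y - y')) * block h m' m y y' x x')"
proof -
  define l X Y where "l = m - m'" and "X = x - x'" and "Y = y - y'"
  have 1: "th l * th (X + Y) * (th (x' - y' + m) * th (x - y + m')) =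
      th Y * th (l - X) * (th (x - y' + m) * th (x' - y + m')) +
      th (l + Y) * th X * (th (x - y' + m') * th (x' - y + m))"
    using th_three_term'[of l Y "x - y + m'" "x' - y + m'"]
    by (simp add: l_def X_def Y_def algebra_simps)
  have "th (- Y - X) = - th (X + Y)"
    using th_minus[of "Y + X"] by (simp add: add.commute[of X])
  then have 2: "th (h + X) * th Y * (th (x - y') * th (h + x' - y)) =
      th h * th (X + Y) * (th (x' - y') * th (h + x - y)) -
      th X * th (h - Y) * (th (x' - y) * th (h + x - y'))"
    using th_three_term'[of "- Y" h "x - y'" "x' - y'"] th_minus[of Y]
    by (simp add: X_def Y_def algebra_simps)
  have "th l * th (h + X) * th Y * block h m m' y' y x' x =
      th l * (th (x' - y' + m) * th (x - y + m')) * (th (h + X) * th Y * (th (x - y') * th (h + x' - y)))"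
    by (simp add: block_def mult_ac)
  also have "\<dots> = th h * (th (x' - y') * th (h + x - y)) *
        (th l * th (X + Y) * (th (x' - y' + m) * th (x - y + m')))
      - th X * th l * th (h - Y) * (th (x' - y' + m) * th (x - y + m') * (th (x' - y) * th (h + x - y')))"
    unfolding 2 by (simp add: algebra_simps)
  also have "\<dots> = th h * th (l - X) * th Y * block h m m' y' y x x' +
      th X * (th h * th (l + Y) * block h m' m y' y x x' - th l * th (h - Y) * block h m' m y y' x x')"
    unfolding 1 by (simp add: block_def algebra_simps)
  finally show ?thesis
    by (simp add: l_def X_def Y_def)
qed

text \<open>The diagonal coefficient follows from two instances of the off-diagonal one,
  because exchanging twice is the identity (\<open>th_unitarity\<close>).\<close>

lemma block_exchange_diag:
  assumes "th (x - x') \<noteq> 0"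
  shows "th (m - m') * th (h + (x - x')) *
      (th h * th (m - m' - (y - y')) * block h m m' y' y x' x
        - th (m - m') * th (h - (y - y')) * block h m m' y y' x' x) =
    th h * th (m - m' - (x - x')) *
      (th h * th (m - m' - (y - y')) * block h m m' y' y x x'
        - th (m - m') * th (h - (y - y')) * block h m m' y y' x x')
    - th (h + (m - m')) * th (h - (m - m')) * th (x - x') * th (y - y') * block h m' m y' y x x'"
proof -
  define l X Y where "l = m - m'" and "X = x - x'" and "Y = y - y'"
  \<comment> \<open>\<open>block_exchange_offdiag\<close> with m and m' exchanged expresses
    \<open>P\<close> through \<open>Q\<close> alone, for either order of x and x'. The claim then
    becomes an identity between coefficients of \<open>Q\<close>.\<close>
  define P where "P u v = th h * th (l - Y) * block h m m' y' y u v
    - th l * th (h - Y) * block h m m' y y' u v" for u v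
  define Q where "Q u v = block h m' m y' y u v" for u v
  have P: "th (u - v) * P u v = th l * th (h + (u - v)) * th Y * Q v u
      - th h * th (l + (u - v)) * th Y * Q u v" for u v
  proof -
    have "m' - m = - l" "m' - m - (u - v) = - (l + (u - v))" "m' - m + Y = - (l - Y)"
      by (simp_all add: l_def Y_def)
    then show ?thesis
      using block_exchange_offdiag[of m' m h u v y y']
      by (simp only: P_def Q_def th_minus flip: Y_def) (simp add: algebra_simps)
  qed
  have neg: "x' - x = - X" "th (h + - X) = th (h - X)" "th (l + - X) = th (l - X)"
    by (simp_all add: X_def diff_conv_add_uminus del: add_uminus_conv_diff)
  have 1: "th X * P x x' = th l * th (h + X) * th Y * Q x' x - th h * th (l + X) * th Y * Q x x'"
    using P[of x x'] by (simp add: X_def)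
  have 2: "th X * P x' x = th h * th (l - X) * th Y * Q x' x - th l * th (h - X) * th Y * Q x x'"
    using P[of x' x] unfolding neg th_minus by (simp add: algebra_simps)
  have "th X * (th l * th (h + X) * P x' x) = th l * th (h + X) * (th X * P x' x)"
    by (simp add: mult_ac)
  also have "\<dots> = th h * th (l - X) * (th X * P x x') +
      (th h ^ 2 * (th (l - X) * th (l + X)) - th l ^ 2 * (th (h + X) * th (h - X))) * th Y * Q x x'"
    unfolding 1 2 by (simp add: power2_eq_square algebra_simps)
  also have "\<dots> = th X * (th h * th (l - X) * P x x' - th (h + l) * th (h - l) * th X * th Y * Q x x')"
    unfolding th_unitarity by (simp add: power2_eq_square algebra_simps)
  finally show ?thesis
    using assms by (simp add: P_def Q_def l_def X_def Y_def)
qed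

text \<open>Here w, ws are the weights one level down at an assignment and at its swap, and v, vs
  are those for the other permutation. The hypotheses are the exchange relation on that level, for
  both permutations; the conclusion is the relation one level up.\<close>

lemma block_exchange:
  assumes nz: "th (m - m') \<noteq> 0" "th (x - x') \<noteq> 0" "th (y - y') \<noteq> 0"
      "th (h + (y - y')) \<noteq> 0" "th (h - (y - y')) \<noteq> 0"
    and w: "th (m - m') * th (h + (y - y')) * ws =
        th h * th (m - m' - (y - y')) * w + th (h + (m - m')) * th (y - y') * v"
    and v: "th (m' - m) * th (h + (y - y')) * vs =
        th h * th (m' - m - (y - y')) * v + th (h + (m' - m)) * th (y - y') * w"
  shows "th (m - m') * th (h + (x - x')) *
      (block h m m' y y' x' x / (th (h + (y - y')) * th (y' - y)) * w +
       block h m m' y' y x' x / (th (h + (y' - y)) * th (y - y')) * ws) =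
    th h * th (m - m' - (x - x')) *
      (block h m m' y y' x x' / (th (h + (y - y')) * th (y' - y)) * w +
       block h m m' y' y x x' / (th (h + (y' - y)) * th (y - y')) * ws) +
    th (h + (m - m')) * th (x - x') *
      (block h m' m y y' x x' / (th (h + (y - y')) * th (y' - y)) * v +
       block h m' m y' y x x' / (th (h + (y' - y)) * th (y - y')) * vs)"
proof -
  define l X Y where "l = m - m'" and "X = x - x'" and "Y = y - y'"
  have ar: "m - m' = l" "x - x' = X" "y - y' = Y" "m' - m = - l" "y' - y = - Y"
      "h + - Y = h - Y" "h + - l = h - l" "- l - Y = - (l + Y)"
    by (simp_all add: l_def X_def Y_def)
  note nz = nz[unfolded ar] and w = w[unfolded ar] and v = v[unfolded ar]
  note off = block_exchange_offdiag[of m m' h x x' y y', unfolded ar]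
  note diag = block_exchange_diag[of x x' m m' h y y', unfolded ar, OF nz(2)]
  \<comment> \<open>\<open>K\<close> clears the denominators of both summands and also supplies the
    factors needed to replace \<open>ws\<close> and \<open>vs\<close> by means of the
    hypotheses.\<close>
  define K where "K = th (h + Y) * th (h - Y) * th Y * th l"
  have "K \<noteq> 0"
    using nz by (simp add: K_def)
  have Kw: "K * (g / (th (h + Y) * th (- Y)) * w + g' / (th (h - Y) * th Y) * ws) =
      (th h * th (l - Y) * g' - th l * th (h - Y) * g) * w + th (h + l) * (th Y * g') * v" for g g'
  proof -
    have "K * (g / (th (h + Y) * th (- Y)) * w + g' / (th (h - Y) * th Y) * ws) =
        - (th l * th (h - Y) * g) * w + g' * (th l * th (h + Y) * ws)"
      using nz unfolding K_def th_minus by (simp add: field_simps)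
    then show ?thesis
      unfolding w by (simp add: algebra_simps)
  qed
  have Kv: "K * (g / (th (h + Y) * th (- Y)) * v + g' / (th (h - Y) * th Y) * vs) =
      (th h * th (l + Y) * g' - th l * th (h - Y) * g) * v - th (h - l) * (th Y * g') * w" for g g'
  proof -
    have "K * (g / (th (h + Y) * th (- Y)) * v + g' / (th (h - Y) * th Y) * vs) =
        - (th l * th (h - Y) * g) * v - g' * (th (- l) * th (h + Y) * vs)"
      using nz unfolding K_def th_minus by (simp add: field_simps)
    then show ?thesis
      unfolding v by (simp only: th_minus) (simp add: algebra_simps)
  qed
  let ?L = "\<lambda>a b g g'. g / (th (h + Y) * th (- Y)) * a + g' / (th (h - Y) * th Y) * b"
  let ?b = "block h m m' y y'" and ?b' = "block h m m' y' y" and ?c = "block h m' m y y'" and ?c' = "block h m' m y' y"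
  have "K * (th l * th (h + X) * ?L w ws (?b x' x) (?b' x' x)) =
      th l * th (h + X) * (K * ?L w ws (?b x' x) (?b' x' x))"
    by (simp only: mult_ac)
  also have "\<dots> = (th l * th (h + X) * (th h * th (l - Y) * ?b' x' x - th l * th (h - Y) * ?b x' x)) * w +
      th (h + l) * (th l * th (h + X) * th Y * ?b' x' x) * v"
    unfolding Kw by (simp only: distrib_left mult_ac)
  also have "\<dots> = th h * th (l - X) * (K * ?L w ws (?b x x') (?b' x x')) +
      th (h + l) * th X * (K * ?L v vs (?c x x') (?c' x x'))"
    unfolding off diag Kw Kv by (simp add: algebra_simps)
  also have "\<dots> = K * (th h * th (l - X) * ?L w ws (?b x x') (?b' x x') +
      th (h + l) * th X * ?L v vs (?c x x') (?c' x x'))"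
    by (simp only: distrib_left mult_ac)
  finally show ?thesis
    using \<open>K \<noteq> 0\<close> unfolding ar by (simp only: mult_cancel_left) blast
qed

end

section \<open>Weight functions indexed by values\<close>

abbreviation adj :: "nat \<Rightarrow> nat \<Rightarrow> nat" where
  "adj a \<equiv> Transposition.transpose a (Suc a)"

lemma adj_less_iff:
  assumes "v \<in> S" "w \<in> S" "\<not> (a \<in> S \<and> Suc a \<in> S)"
  shows "adj a v < adj a w \<longleftrightarrow> v < w"
proof -
  have "\<not> (v = a \<and> w = Suc a)" "\<not> (v = Suc a \<and> w = a)"
    using assms by auto
  then show ?thesis
    by (auto simp: Transposition.transpose_def)
qed

lemma adj_less_iff_right:
  assumes "w \<notin> {a, Suc a}"
  shows "adj a v < w \<longleftrightarrow> v < w" "w < adj a v \<longleftrightarrow> w < v" "adj a v = w \<longleftrightarrow> v = w"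
  using assms by (auto simp: Transposition.transpose_def)

lemma inv_transpose: "inv (Transposition.transpose a b) = Transposition.transpose a b"
  by (rule inv_unique_comp) auto

lemma inv_adj_comp:
  assumes "bij I"
  shows "inv (adj a \<circ> I) = inv I \<circ> adj a"
  using assms by (simp add: o_inv_distrib inv_transpose)

lemma mem_image_adj: "v \<in> adj a ` S \<longleftrightarrow> adj a v \<in> S"
  by (metis image_iff transpose_involutory)

lemma image_adj_diff: "adj a ` S - {a, Suc a} = S - {a, Suc a}"
proof (rule set_eqI)
  show "v \<in> adj a ` S - {a, Suc a} \<longleftrightarrow> v \<in> S - {a, Suc a}" for v
    unfolding Diff_iff mem_image_adj by (cases "v \<in> {a, Suc a}") auto
qed

lemma image_adj:
  assumes "a \<in> S" "Suc a \<in> S"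
  shows "adj a ` S = S"
  using assms by simp

lemma prod_pairs_adj:
  fixes g :: "nat \<Rightarrow> nat \<Rightarrow> complex"
  assumes "a \<in> S" "Suc a \<in> S"
  shows "(\<Prod>(v, w)\<in>{(v, w). v \<in> S \<and> w \<in> S \<and> v < w} - {(a, Suc a)}. g (adj a v) (adj a w)) =
    (\<Prod>(v, w)\<in>{(v, w). v \<in> S \<and> w \<in> S \<and> v < w} - {(a, Suc a)}. g v w)"
proof (rule prod.reindex_bij_witness[where i = "map_prod (adj a) (adj a)" and j = "map_prod (adj a) (adj a)"])
  fix p assume p: "p \<in> {(v, w). v \<in> S \<and> w \<in> S \<and> v < w} - {(a, Suc a)}"
  obtain v w where vw: "p = (v, w)"
    by fastforce
  have "adj a v \<in> S" "adj a w \<in> S"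
    using p vw image_adj[OF assms] by auto
  moreover have "adj a v < adj a w" "(adj a v, adj a w) \<noteq> (a, Suc a)"
    using p vw by (auto simp: Transposition.transpose_def split: if_splits)
  ultimately show "map_prod (adj a) (adj a) p \<in> {(v, w). v \<in> S \<and> w \<in> S \<and> v < w} - {(a, Suc a)}"
    by (simp add: vw)
  then show "map_prod (adj a) (adj a) p \<in> {(v, w). v \<in> S \<and> w \<in> S \<and> v < w} - {(a, Suc a)}" .
qed auto

lemma finite_pairs: "finite S \<Longrightarrow> finite {(v, w). v \<in> S \<and> w \<in> S \<and> v < (w :: nat)}"
  by (rule finite_subset[of _ "S \<times> S"]) auto

text \<open>Extensionality fixes the function outside \<open>S\<close>, so that each bijection is
  counted exactly once in a sum.\<close>

definition assignments :: "nat set \<Rightarrow> complex set \<Rightarrow> (nat \<Rightarrow> complex) set" where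
  "assignments S Z = {y \<in> extensional S. bij_betw y S Z}"

lemma finite_assignments:
  assumes "finite S" "finite Z"
  shows "finite (assignments S Z)"
proof (rule finite_subset)
  show "assignments S Z \<subseteq> (S \<rightarrow>\<^sub>E Z)"
  proof
    fix y assume "y \<in> assignments S Z"
    then have "y \<in> extensional S" "bij_betw y S Z"
      by (simp_all add: assignments_def)
    then show "y \<in> (S \<rightarrow>\<^sub>E Z)"
      unfolding PiE_iff using bij_betw_apply by metis
  qed
  show "finite (S \<rightarrow>\<^sub>E Z)"
    using assms by (intro finite_PiE) auto
qed

lemma assignments_adj:
  "bij_betw (\<lambda>y. y \<circ> adj a) (assignments S Z) (assignments (adj a ` S) Z)"
proof -
  have "y \<circ> adj a \<in> assignments (adj a ` S) Z" if "y \<in> assignments S Z" for y S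
  proof -
    have "bij_betw (adj a) (adj a ` S) S"
      by (rule bij_betw_byWitness[where f' = "adj a"]) auto
    then have "bij_betw (y \<circ> adj a) (adj a ` S) Z"
      using that by (auto simp: assignments_def intro: bij_betw_trans)
    moreover have "y \<circ> adj a \<in> extensional (adj a ` S)"
      using that by (auto simp: assignments_def extensional_def) (metis image_eqI transpose_involutory)
    ultimately show ?thesis
      by (simp add: assignments_def)
  qed
  from this[of _ S] this[of _ "adj a ` S"] show ?thesis
    by (intro bij_betw_byWitness[where f' = "\<lambda>y. y \<circ> adj a"])
      (auto simp: image_subset_iff comp_assoc image_comp)
qed

lemma sum_assignments_adj:
  "(\<Sum>y\<in>assignments (adj a ` S) Z. f y) = (\<Sum>y\<in>assignments S Z. f (y \<circ> adj a))"
  by (rule sum.reindex_bij_betw[OF assignments_adj, symmetric])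

context nome
begin

text \<open>The variables \<open>t\<^sup>(\<^sup>k\<^sup>)\<close> are indexed here by the values in \<open>{I\<^sub>1, \<dots>, I\<^sub>k}\<close> instead of by their ranks.
  Then the symmetrization of a restricted weight function is a sum over the bijections from
  these values to a set \<open>Z k\<close> of \<open>k\<close> numbers.\<close>

definition psi_val :: "complex \<Rightarrow> (nat \<Rightarrow> nat) \<Rightarrow> (nat \<Rightarrow> complex) \<Rightarrow> nat \<Rightarrow> nat \<Rightarrow> nat \<Rightarrow> complex \<Rightarrow> complex" where
  "psi_val h I mu k v c u =
    (if c < v then th (h + u)
     else if c = v then th (u + of_int (1 - p_ind I (k + 1) v) * h + mu (k + 1) - mu (inv I v))
     else th u)"

definition level_num :: "complex \<Rightarrow> (nat \<Rightarrow> nat) \<Rightarrow> (nat \<Rightarrow> complex) \<Rightarrow> nat \<Rightarrow>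
    (nat \<Rightarrow> complex) \<Rightarrow> (nat \<Rightarrow> complex) \<Rightarrow> complex" where
  "level_num h I mu k y x = (\<Prod>v\<in>I ` {1..k}. \<Prod>c\<in>I ` {1..k + 1}. psi_val h I mu k v c (x c - y v))"

definition level_den :: "complex \<Rightarrow> nat set \<Rightarrow> (nat \<Rightarrow> complex) \<Rightarrow> complex" where
  "level_den h S y = (\<Prod>(v, w) | v \<in> S \<and> w \<in> S \<and> v < w. th (h + y v - y w) * th (y w - y v))"

text \<open>Level k is the only one linking \<open>x\<close> with the summation variable
  \<open>y\<close>, so the symmetrizations unfold into a recursion. \<open>Z k\<close> records the
  numbers substituted on level k without an order; this is why J will enter only through the sets of
  its initial entries.\<close>

primrec weight :: "complex \<Rightarrow> (nat \<Rightarrow> nat) \<Rightarrow> (nat \<Rightarrow> complex) \<Rightarrow> (nat \<Rightarrow> complex set) \<Rightarrow> nat \<Rightarrow>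
    (nat \<Rightarrow> complex) \<Rightarrow> complex" where
  "weight h I mu Z 0 x = 1"
| "weight h I mu Z (Suc k) x = (\<Sum>y\<in>assignments (I ` {1..k}) (Z k).
     level_num h I mu k y x / level_den h (I ` {1..k}) y * weight h I mu Z k y)"

lemma psi_val_adj_comp:
  assumes "bij I" "(adj a c < adj a v) = (c < v)" "(adj a (I (Suc k)) < adj a v) = (I (Suc k) < v)"
  shows "psi_val h (adj a \<circ> I) mu k (adj a v) (adj a c) u = psi_val h I mu k v c u"
proof -
  have "(adj a c = adj a v) = (c = v)"
    by (metis transpose_involutory)
  then show ?thesis
    using assms by (simp add: psi_val_def p_ind_def inv_adj_comp)
qed

lemma level_den_adj:
  assumes "\<not> (a \<in> S \<and> Suc a \<in> S)"
  shows "level_den h (adj a ` S) (y \<circ> adj a) = level_den h S y"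
  unfolding level_den_def
proof (rule prod.reindex_bij_witness[where i = "map_prod (adj a) (adj a)" and j = "map_prod (adj a) (adj a)"])
  fix p :: "nat \<times> nat"
  assume "p \<in> {(v, w). v \<in> adj a ` S \<and> w \<in> adj a ` S \<and> v < w}"
  then obtain v w where p: "p = (adj a v, adj a w)" "v \<in> S" "w \<in> S" "adj a v < adj a w"
    by auto
  then show "map_prod (adj a) (adj a) p \<in> {(v, w). v \<in> S \<and> w \<in> S \<and> v < w}"
    using adj_less_iff[OF p(2,3) assms] by simp
next
  fix p assume "p \<in> {(v, w). v \<in> S \<and> w \<in> S \<and> v < w}"
  then show "map_prod (adj a) (adj a) p \<in> {(v, w). v \<in> adj a ` S \<and> w \<in> adj a ` S \<and> v < w}"
    using adj_less_iff[OF _ _ assms] by auto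
qed auto

text \<open>Only the relative order of the values and their positions in \<open>I\<close> matter.
  \<open>adj a\<close> keeps all positions and reverses the order of the pair a, a + 1 only, which
  is not contained in the set.\<close>

lemma weight_relabel:
  assumes "bij I" "\<not> (a \<in> I ` {1..k} \<and> Suc a \<in> I ` {1..k})"
  shows "weight h (adj a \<circ> I) mu Z k (x \<circ> adj a) = weight h I mu Z k x"
  using assms(2)
proof (induction k arbitrary: x)
  case (Suc k)
  let ?S = "I ` {1..k}"
  have notin: "\<not> (a \<in> ?S \<and> Suc a \<in> ?S)"
    using Suc.prems by auto
  have inj: "inj_on (adj a) A" for A
    by simp
  have "level_num h (adj a \<circ> I) mu k (y \<circ> adj a) (x \<circ> adj a) = level_num h I mu k y x" for y
  proof -
    have "(\<Prod>v\<in>adj a ` ?S. \<Prod>c\<in>adj a ` I ` {1..k+1}.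
        psi_val h (adj a \<circ> I) mu k v c (x (adj a c) - y (adj a v))) = level_num h I mu k y x"
      unfolding level_num_def prod.reindex[OF inj] o_def transpose_involutory
    proof (intro prod.cong refl)
      fix v c assume "v \<in> ?S" "c \<in> I ` {1..k+1}"
      then show "psi_val h (\<lambda>x. adj a (I x)) mu k (adj a v) (adj a c) (x c - y v) =
          psi_val h I mu k v c (x c - y v)"
        using psi_val_adj_comp[OF assms(1), of a c v k h mu] adj_less_iff[OF _ _ Suc.prems]
        by (auto simp: o_def)
    qed
    then show ?thesis
      by (simp add: level_num_def image_comp)
  qed
  then show ?case
    by (simp only: weight.simps image_comp[symmetric] sum_assignments_adj level_den_adj[OF notin] Suc.IH[OF notin])
qed simp

text \<open>The factor of a level numerator common to all terms of an exchange relation: what is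
  left out are the factors with both indices in {a, a + 1}, the only ones that feel the
  swap.\<close>

definition rest_num :: "complex \<Rightarrow> (nat \<Rightarrow> nat) \<Rightarrow> (nat \<Rightarrow> complex) \<Rightarrow> nat \<Rightarrow> nat \<Rightarrow>
    (nat \<Rightarrow> complex) \<Rightarrow> (nat \<Rightarrow> complex) \<Rightarrow> complex" where
  "rest_num h I mu k a y x =
    (\<Prod>v\<in>I ` {1..k} - {a, Suc a}. \<Prod>c\<in>I ` {1..k + 1}. psi_val h I mu k v c (x c - y v)) *
    (\<Prod>c\<in>I ` {1..k + 1} - {a, Suc a}. \<Prod>v\<in>I ` {1..k} \<inter> {a, Suc a}. psi_val h I mu k v c (x c - y v))"

lemma psi_val_adj_column:
  assumes "v \<notin> {a, Suc a}"
  shows "psi_val h I mu k v (adj a c) = psi_val h I mu k v c"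
  using adj_less_iff_right[OF assms, of c] by (auto simp: psi_val_def fun_eq_iff)

lemma psi_val_adj_comp_row:
  assumes "bij I" "v \<notin> {a, Suc a}"
  shows "psi_val h (adj a \<circ> I) mu k v c = psi_val h I mu k v c"
proof -
  have "adj a v = v"
    using assms by auto
  then show ?thesis
    using assms adj_less_iff_right[OF assms(2)]
    by (simp add: psi_val_def p_ind_def inv_adj_comp fun_eq_iff)
qed

lemma psi_val_off_diagonal:
  assumes "c \<noteq> v"
  shows "psi_val h I mu k v c u = (if c < v then th (h + u) else th u)"
  using assms by (simp add: psi_val_def)

lemma level_num_split:
  assumes "a \<in> I ` {1..k + 1}" "Suc a \<in> I ` {1..k + 1}"
  shows "level_num h I mu k y x = rest_num h I mu k a y x *
    (\<Prod>v\<in>I ` {1..k} \<inter> {a, Suc a}. psi_val h I mu k v a (x a - y v) * psi_val h I mu k v (Suc a) (x (Suc a) - y v))"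
proof -
  let ?S = "I ` {1..k}" and ?T = "I ` {1..k + 1}" and ?f = "\<lambda>v c. psi_val h I mu k v c (x c - y v)"
  have row: "(\<Prod>c\<in>?T. ?f v c) = (\<Prod>c\<in>?T - {a, Suc a}. ?f v c) * (?f v a * ?f v (Suc a))" for v
    using assms by (subst prod.subset_diff[of "{a, Suc a}"]) auto
  have "level_num h I mu k y x = (\<Prod>v\<in>?S - {a, Suc a}. \<Prod>c\<in>?T. ?f v c) *
      (\<Prod>v\<in>?S \<inter> {a, Suc a}. \<Prod>c\<in>?T. ?f v c)"
    unfolding level_num_def by (subst prod.Int_Diff[of _ _ "{a, Suc a}"]) (simp_all add: mult.commute)
  also have "(\<Prod>v\<in>?S \<inter> {a, Suc a}. \<Prod>c\<in>?T. ?f v c) =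
      (\<Prod>c\<in>?T - {a, Suc a}. \<Prod>v\<in>?S \<inter> {a, Suc a}. ?f v c) * (\<Prod>v\<in>?S \<inter> {a, Suc a}. ?f v a * ?f v (Suc a))"
    unfolding row prod.distrib by (subst prod.swap) simp
  finally show ?thesis
    by (simp add: rest_num_def mult_ac)
qed

text \<open>A row index outside {a, a + 1} lies on the same side of a and of a + 1, so the two
  columns have the same form there; the other columns are untouched by the swap.\<close>

lemma rest_num_swap_columns:
  assumes "a \<in> I ` {1..k + 1}" "Suc a \<in> I ` {1..k + 1}"
  shows "rest_num h I mu k a y (x \<circ> adj a) = rest_num h I mu k a y x"
proof -
  let ?T = "I ` {1..k + 1}"
  have 0: "(\<Prod>c\<in>?T. psi_val h I mu k v c ((x \<circ> adj a) c - y v)) = (\<Prod>c\<in>?T. psi_val h I mu k v c (x c - y v))"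
    if "v \<notin> {a, Suc a}" for v
  proof -
    have "(\<Prod>c\<in>?T. psi_val h I mu k v c ((x \<circ> adj a) c - y v)) =
        (\<Prod>c\<in>adj a ` ?T. psi_val h I mu k v c (x c - y v))"
      by (simp add: prod.reindex psi_val_adj_column[OF that])
    then show ?thesis
      unfolding image_adj[OF assms] .
  qed
  have 1: "(\<Prod>v\<in>I ` {1..k} - {a, Suc a}. \<Prod>c\<in>?T. psi_val h I mu k v c ((x \<circ> adj a) c - y v)) =
      (\<Prod>v\<in>I ` {1..k} - {a, Suc a}. \<Prod>c\<in>?T. psi_val h I mu k v c (x c - y v))"
    by (rule prod.cong[OF refl], rule 0) auto
  have 2: "(\<Prod>c\<in>?T - {a, Suc a}. \<Prod>v\<in>I ` {1..k} \<inter> {a, Suc a}. psi_val h I mu k v c ((x \<circ> adj a) c - y v)) =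
      (\<Prod>c\<in>?T - {a, Suc a}. \<Prod>v\<in>I ` {1..k} \<inter> {a, Suc a}. psi_val h I mu k v c (x c - y v))"
    by (rule prod.cong[OF refl]) simp
  show ?thesis
    unfolding rest_num_def 1 2 ..
qed

lemma rest_num_swap_rows:
  assumes "a \<in> I ` {1..k}" "Suc a \<in> I ` {1..k}"
  shows "rest_num h I mu k a (y \<circ> adj a) x = rest_num h I mu k a y x"
proof -
  have 1: "I ` {1..k} \<inter> {a, Suc a} = {a, Suc a}"
    using assms by auto
  have 2: "(\<Prod>c\<in>I ` {1..k + 1} - {a, Suc a}. \<Prod>v\<in>{a, Suc a}. psi_val h I mu k v c (x c - (y \<circ> adj a) v)) =
      (\<Prod>c\<in>I ` {1..k + 1} - {a, Suc a}. \<Prod>v\<in>{a, Suc a}. psi_val h I mu k v c (x c - y v))"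
    by (rule prod.cong[OF refl]) (auto simp: psi_val_off_diagonal)
  have 3: "(\<Prod>v\<in>I ` {1..k} - {a, Suc a}. \<Prod>c\<in>I ` {1..k + 1}. psi_val h I mu k v c (x c - (y \<circ> adj a) v)) =
      (\<Prod>v\<in>I ` {1..k} - {a, Suc a}. \<Prod>c\<in>I ` {1..k + 1}. psi_val h I mu k v c (x c - y v))"
    by (rule prod.cong[OF refl]) simp
  show ?thesis
    unfolding rest_num_def 1 2 3 ..
qed

text \<open>The separate \<open>y'\<close> covers two situations: \<open>y' = y\<close> when both
  values occur on the lower level, and \<open>y' = y \<circ> adj a\<close> when only one does. In
  either case \<open>prod\<close> compares the rows with index in {a, a + 1}.\<close>

lemma rest_num_adj_comp:
  assumes "bij I" "a \<in> I ` {1..k + 1}" "Suc a \<in> I ` {1..k + 1}"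
    and y: "\<And>v. v \<notin> {a, Suc a} \<Longrightarrow> y' v = y v"
    and prod: "\<And>c. c \<notin> {a, Suc a} \<Longrightarrow>
      (\<Prod>v\<in>adj a ` I ` {1..k} \<inter> {a, Suc a}. psi_val h (adj a \<circ> I) mu k v c (x c - y' v)) =
      (\<Prod>v\<in>I ` {1..k} \<inter> {a, Suc a}. psi_val h I mu k v c (x c - y v))"
  shows "rest_num h (adj a \<circ> I) mu k a y' x = rest_num h I mu k a y x"
proof -
  have 1: "adj a ` I ` {1..k} - {a, Suc a} = I ` {1..k} - {a, Suc a}"
    by (rule image_adj_diff)
  have 2: "(\<Prod>v\<in>I ` {1..k} - {a, Suc a}. \<Prod>c\<in>I ` {1..k + 1}. psi_val h (adj a \<circ> I) mu k v c (x c - y' v)) =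
      (\<Prod>v\<in>I ` {1..k} - {a, Suc a}. \<Prod>c\<in>I ` {1..k + 1}. psi_val h I mu k v c (x c - y v))"
    by (rule prod.cong[OF refl]) (simp add: psi_val_adj_comp_row[OF assms(1)] y)
  have 3: "(\<Prod>c\<in>I ` {1..k + 1} - {a, Suc a}.
        \<Prod>v\<in>adj a ` I ` {1..k} \<inter> {a, Suc a}. psi_val h (adj a \<circ> I) mu k v c (x c - y' v)) =
      (\<Prod>c\<in>I ` {1..k + 1} - {a, Suc a}.
        \<Prod>v\<in>I ` {1..k} \<inter> {a, Suc a}. psi_val h I mu k v c (x c - y v))"
    by (rule prod.cong[OF refl], rule prod) auto
  show ?thesis
    unfolding rest_num_def image_comp[symmetric] image_adj[OF assms(2,3)] 1 2 3 ..
qed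

definition rest_den :: "complex \<Rightarrow> nat set \<Rightarrow> nat \<Rightarrow> (nat \<Rightarrow> complex) \<Rightarrow> complex" where
  "rest_den h S a y = (\<Prod>(v, w)\<in>{(v, w). v \<in> S \<and> w \<in> S \<and> v < w} - {(a, Suc a)}.
     th (h + y v - y w) * th (y w - y v))"

lemma level_den_split:
  assumes "finite S" "a \<in> S" "Suc a \<in> S"
  shows "level_den h S y = rest_den h S a y * (th (h + (y a - y (Suc a))) * th (y (Suc a) - y a))"
proof -
  note fin = finite_pairs[OF assms(1)]
  show ?thesis
    unfolding level_den_def rest_den_def
    by (subst prod.remove[OF fin, of "(a, Suc a)"]) (use assms in \<open>auto simp: algebra_simps\<close>)
qed

lemma rest_den_adj:
  assumes "a \<in> S" "Suc a \<in> S"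
  shows "rest_den h S a (y \<circ> adj a) = rest_den h S a y"
  unfolding rest_den_def comp_apply by (rule prod_pairs_adj[OF assms])

section \<open>The exchange relation\<close>

definition generic :: "complex \<Rightarrow> complex set \<Rightarrow> bool" where
  "generic h G \<longleftrightarrow> (\<forall>u\<in>G. \<forall>v\<in>G. u \<noteq> v \<longrightarrow> th (u - v) \<noteq> 0 \<and> th (h + (u - v)) \<noteq> 0)"

text \<open>The swap permutes the assignments, so twice the sum is the sum of the vanishing pairs.
  No choice of one representative per pair is needed.\<close>

lemma sum_assignments_pairing:
  assumes "a \<in> S" "Suc a \<in> S" "\<And>y. y \<in> assignments S Z \<Longrightarrow> T y + T (y \<circ> adj a) = 0"
  shows "(\<Sum>y\<in>assignments S Z. T y) = (0 :: complex)"
proof -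
  have "(\<Sum>y\<in>assignments S Z. T (y \<circ> adj a)) = (\<Sum>y\<in>assignments S Z. T y)"
    using sum_assignments_adj[of T a S Z] unfolding image_adj[OF assms(1,2)] by simp
  moreover have "(\<Sum>y\<in>assignments S Z. T y + T (y \<circ> adj a)) = 0"
    by (rule sum.neutral) (use assms(3) in simp)
  ultimately show ?thesis
    by (simp add: sum.distrib)
qed

text \<open>The summands for \<open>y\<close> and \<open>y \<circ> adj a\<close> are taken together: the relation for the two of
  them is \<open>block_exchange\<close>.\<close>

lemma weight_exchange_inherit:
  assumes I: "bij I" and S: "a \<in> I ` {1..k}" "Suc a \<in> I ` {1..k}"
    and top: "I (Suc k) \<notin> {a, Suc a}"
    and G: "generic h G" "Z k \<subseteq> G"
    and mu: "th (mu (inv I (Suc a)) - mu (inv I a)) \<noteq> 0"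
    and x: "th (x a - x (Suc a)) \<noteq> 0"
    and IH: "\<And>y I. bij I \<Longrightarrow> a \<in> I ` {1..k} \<Longrightarrow> Suc a \<in> I ` {1..k} \<Longrightarrow>
      th (mu (inv I (Suc a)) - mu (inv I a)) \<noteq> 0 \<Longrightarrow> th (y a - y (Suc a)) \<noteq> 0 \<Longrightarrow>
      th (mu (inv I (Suc a)) - mu (inv I a)) * th (h + (y a - y (Suc a))) * weight h I mu Z k (y \<circ> adj a) =
      th h * th (mu (inv I (Suc a)) - mu (inv I a) - (y a - y (Suc a))) * weight h I mu Z k y +
      th (h + (mu (inv I (Suc a)) - mu (inv I a))) * th (y a - y (Suc a)) * weight h (adj a \<circ> I) mu Z k y"
  shows "th (mu (inv I (Suc a)) - mu (inv I a)) * th (h + (x a - x (Suc a))) * weight h I mu Z (Suc k) (x \<circ> adj a) =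
      th h * th (mu (inv I (Suc a)) - mu (inv I a) - (x a - x (Suc a))) * weight h I mu Z (Suc k) x +
      th (h + (mu (inv I (Suc a)) - mu (inv I a))) * th (x a - x (Suc a)) * weight h (adj a \<circ> I) mu Z (Suc k) x"
proof -
  let ?S = "I ` {1..k}" and ?J = "adj a \<circ> I" and ?b = "Suc a"
  have T: "a \<in> I ` {1..k + 1}" "?b \<in> I ` {1..k + 1}"
    using S by auto
  have ab: "?S \<inter> {a, ?b} = {a, ?b}"
    using S by auto
  have adjS: "adj a ` ?S = ?S"
    by (rule image_adj[OF S])
  have J: "bij ?J"
    using I by (intro bij_comp) auto
  have SJ: "?J ` {1..k} = ?S" "?J ` {1..k+1} = I ` {1..k+1}"
    unfolding image_comp[symmetric] image_adj[OF S] image_adj[OF T] by auto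
  have JJ: "adj a \<circ> ?J = I"
    by (simp add: comp_assoc[symmetric])
  have topJ: "?J (Suc k) = I (Suc k)"
    using top by simp
  define e where "e = of_int (1 - p_ind I (Suc k) a) * h"
  \<comment> \<open>The entry on position k + 1 is neither a nor a + 1, hence smaller than both or
    larger than both. So both factors with equal indices carry the same power of hbar.\<close>
  have p: "p_ind I (Suc k) ?b = p_ind I (Suc k) a"
    using top by (auto simp: p_ind_def)
  define m m' where "m = e + mu (k + 1) - mu (inv I a)" and "m' = e + mu (k + 1) - mu (inv I ?b)"
  have mm: "m - m' = mu (inv I ?b) - mu (inv I a)"
    by (simp add: m_def m'_def)
  have muJ: "mu (inv ?J ?b) - mu (inv ?J a) = m' - m"
    using I by (simp add: inv_adj_comp m_def m'_def)
  have num: "level_num h I mu k y x = rest_num h I mu k a y x * block h m m' (y a) (y ?b) (x a) (x ?b)" for x y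
    unfolding level_num_split[OF T] ab
    by (simp add: psi_val_def block_def m_def m'_def e_def p algebra_simps)
  have numJ: "level_num h ?J mu k y x = rest_num h I mu k a y x * block h m' m (y a) (y ?b) (x a) (x ?b)" for x y
  proof -
    have "rest_num h ?J mu k a y x = rest_num h I mu k a y x"
      by (rule rest_num_adj_comp[OF I T, unfolded adjS ab]) (auto simp: psi_val_off_diagonal)
    moreover have "p_ind ?J (Suc k) ?b = p_ind I (Suc k) a" "p_ind ?J (Suc k) a = p_ind I (Suc k) a"
      using top by (auto simp: p_ind_def)
    ultimately show ?thesis
      unfolding level_num_split[of a ?J k, unfolded SJ, OF T] ab
      using I by (simp add: psi_val_def block_def m_def m'_def e_def inv_adj_comp algebra_simps)
  qed
  have den: "level_den h ?S y = rest_den h ?S a y * (th (h + (y a - y ?b)) * th (y ?b - y a))" for y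
    by (rule level_den_split) (use S in auto)
  define D where "D y = weight h I mu Z k y" for y
  define E where "E y = weight h ?J mu Z k y" for y
  define X where "X = x a - x ?b"
  define T where "T y = th (m - m') * th (h + X) * (level_num h I mu k y (x \<circ> adj a) / level_den h ?S y * D y)
    - (th h * th (m - m' - X) * (level_num h I mu k y x / level_den h ?S y * D y)
      + th (h + (m - m')) * th X * (level_num h ?J mu k y x / level_den h ?S y * E y))" for y
  have "T y + T (y \<circ> adj a) = 0" if y: "y \<in> assignments ?S (Z k)" for y
  proof -
    have "inj_on y ?S" "y ` ?S = Z k"
      using y by (auto simp: assignments_def bij_betw_def)
    then have "y a \<in> G" "y ?b \<in> G" "y a \<noteq> y ?b"
      using S G(2) inj_onD[of y ?S a ?b] by auto
    then have Y: "th (y a - y ?b) \<noteq> 0" "th (h + (y a - y ?b)) \<noteq> 0" "th (h + (y ?b - y a)) \<noteq> 0"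
      using G(1) unfolding generic_def by (metis)+
    have neg: "h - (y a - y ?b) = h + (y ?b - y a)"
      by simp
    have w: "th (m - m') * th (h + (y a - y ?b)) * D (y \<circ> adj a) =
        th h * th (m - m' - (y a - y ?b)) * D y + th (h + (m - m')) * th (y a - y ?b) * E y"
      using IH[OF I S mu Y(1)] by (simp only: mm D_def E_def)
    have mu': "th (m' - m) \<noteq> 0"
      using mu th_diff[of m' m] by (simp add: mm)
    \<comment> \<open>The companion relation is the induction hypothesis for
      \<open>adj a \<circ> I\<close>, which is why \<open>IH\<close> has to range over all
      permutations; applying \<open>adj a\<close> again leads back to \<open>I\<close>.\<close>
    have v: "th (m' - m) * th (h + (y a - y ?b)) * E (y \<circ> adj a) =
        th h * th (m' - m - (y a - y ?b)) * E y + th (h + (m' - m)) * th (y a - y ?b) * D y"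
      using IH[of ?J y, unfolded SJ JJ muJ, OF J S mu' Y(1)] by (simp only: D_def E_def)
    define r where "r = rest_num h I mu k a y x / rest_den h ?S a y"
    have num_y: "level_num h I mu k y x' / level_den h ?S y * d =
        r * (block h m m' (y a) (y ?b) (x' a) (x' ?b) / (th (h + (y a - y ?b)) * th (y ?b - y a)) * d)"
      if "rest_num h I mu k a y x' = rest_num h I mu k a y x" for x' d
      unfolding num den r_def that by simp
    have num_ys: "level_num h I mu k (y \<circ> adj a) x' / level_den h ?S (y \<circ> adj a) * d =
        r * (block h m m' (y ?b) (y a) (x' a) (x' ?b) / (th (h + (y ?b - y a)) * th (y a - y ?b)) * d)"
      if "rest_num h I mu k a y x' = rest_num h I mu k a y x" for x' d
      unfolding num den rest_num_swap_rows[OF S] rest_den_adj[OF S] r_def that by simp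
    have numJ_y: "level_num h ?J mu k y x / level_den h ?S y * d =
        r * (block h m' m (y a) (y ?b) (x a) (x ?b) / (th (h + (y a - y ?b)) * th (y ?b - y a)) * d)" for d
      unfolding numJ den r_def by simp
    have numJ_ys: "level_num h ?J mu k (y \<circ> adj a) x / level_den h ?S (y \<circ> adj a) * d =
        r * (block h m' m (y ?b) (y a) (x a) (x ?b) / (th (h + (y ?b - y a)) * th (y a - y ?b)) * d)" for d
      unfolding numJ den rest_num_swap_rows[OF S] rest_den_adj[OF S] r_def by simp
    have x': "(x \<circ> adj a) a = x ?b" "(x \<circ> adj a) ?b = x a"
      by simp_all
    have collect: "(c1 * (r * b1) - (c2 * (r * b2) + c3 * (r * b3))) +
        (c1 * (r * b1') - (c2 * (r * b2') + c3 * (r * b3'))) =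
        r * (c1 * (b1 + b1') - (c2 * (b2 + b2') + c3 * (b3 + b3')))" for c1 c2 c3 b1 b2 b3 b1' b2' b3'
      by (simp add: algebra_simps)
    have "T y + T (y \<circ> adj a) = r *
      (th (m - m') * th (h + X) *
        (block h m m' (y a) (y ?b) (x ?b) (x a) / (th (h + (y a - y ?b)) * th (y ?b - y a)) * D y +
         block h m m' (y ?b) (y a) (x ?b) (x a) / (th (h + (y ?b - y a)) * th (y a - y ?b)) * D (y \<circ> adj a)) -
       (th h * th (m - m' - X) *
        (block h m m' (y a) (y ?b) (x a) (x ?b) / (th (h + (y a - y ?b)) * th (y ?b - y a)) * D y +
         block h m m' (y ?b) (y a) (x a) (x ?b) / (th (h + (y ?b - y a)) * th (y a - y ?b)) * D (y \<circ> adj a)) +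
        th (h + (m - m')) * th X *
        (block h m' m (y a) (y ?b) (x a) (x ?b) / (th (h + (y a - y ?b)) * th (y ?b - y a)) * E y +
         block h m' m (y ?b) (y a) (x a) (x ?b) / (th (h + (y ?b - y a)) * th (y a - y ?b)) * E (y \<circ> adj a))))"
      unfolding T_def num_y[OF rest_num_swap_columns[OF T]] num_ys[OF rest_num_swap_columns[OF T]]
        num_y[OF refl] num_ys[OF refl] numJ_y numJ_ys x' collect ..
    also have "\<dots> = 0"
      unfolding X_def
      by (subst block_exchange[where ws = "D (y \<circ> adj a)" and w = "D y" and v = "E y" and vs = "E (y \<circ> adj a)"])
        (use mu x Y w v in \<open>auto simp: mm neg\<close>)
    finally show ?thesis .
  qed
  then have "(\<Sum>y\<in>assignments ?S (Z k). T y) = 0"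
    by (rule sum_assignments_pairing[OF S])
  then show ?thesis
    unfolding weight.simps SJ mm[symmetric] X_def[symmetric]
    by (simp add: T_def sum_subtractf sum.distrib sum_distrib_left D_def E_def)
qed

text \<open>Exactly one of the two values occurs below level \<open>k + 1\<close>: the relation holds
  for each term, by the three-term identity.\<close>

lemma weight_exchange_start:
  assumes I: "bij I" and T: "a \<in> I ` {1..k + 1}" "Suc a \<in> I ` {1..k + 1}"
    and top: "I (Suc k) \<in> {a, Suc a}"
  shows "th (mu (inv I (Suc a)) - mu (inv I a)) * th (h + (x a - x (Suc a))) * weight h I mu Z (Suc k) (x \<circ> adj a) =
      th h * th (mu (inv I (Suc a)) - mu (inv I a) - (x a - x (Suc a))) * weight h I mu Z (Suc k) x +
      th (h + (mu (inv I (Suc a)) - mu (inv I a))) * th (x a - x (Suc a)) * weight h (adj a \<circ> I) mu Z (Suc k) x"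
proof -
  let ?S = "I ` {1..k}" and ?J = "adj a \<circ> I" and ?b = "Suc a"
  \<comment> \<open>The other one of the two values, that is, the one that occurs on the lower
    level.\<close>
  define v where "v = adj a (I (Suc k))"
  have v: "v \<in> {a, ?b}" "adj a v = I (Suc k)"
    using top by (auto simp: v_def)
  have inj: "inj I"
    using I by (rule bij_is_inj)
  have insert: "I ` {1..k + 1} = insert (I (Suc k)) ?S"
    by (simp add: atLeastAtMostSuc_conv)
  have notin: "I (Suc k) \<notin> ?S"
    using inj by (auto simp: inj_image_mem_iff)
  have S: "?S \<inter> {a, ?b} = {v}"
  proof (cases "I (Suc k) = a")
    case True
    then show ?thesis
      using T(2) notin unfolding insert v_def by simp
  next
    case False
    then have "I (Suc k) = ?b"
      using top by simp
    then show ?thesis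
      using T(1) notin unfolding insert v_def by simp
  qed
  have notboth: "\<not> (a \<in> ?S \<and> ?b \<in> ?S)"
    using notin top by auto
  have SJ: "?J ` {1..k} = adj a ` ?S" "?J ` {1..k+1} = I ` {1..k+1}"
    unfolding image_comp[symmetric] image_adj[OF T] by auto
  have SJ': "adj a ` ?S \<inter> {a, ?b} = {adj a v}"
  proof -
    have "adj a ` ?S \<inter> {a, ?b} = adj a ` (?S \<inter> {a, ?b})"
      by (auto simp: mem_image_adj Transposition.transpose_def split: if_splits)
    then show ?thesis
      unfolding S by simp
  qed
  define l X where "l = mu (inv I ?b) - mu (inv I a)" and "X = x a - x ?b"
  have inv_top: "inv I (I (Suc k)) = Suc k"
    using inj by simp
  have num: "level_num h I mu k y x = rest_num h I mu k a y x *
      (psi_val h I mu k v a (x a - y v) * psi_val h I mu k v ?b (x ?b - y v))" for x y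
    unfolding level_num_split[OF T] S by simp
  have numJ: "level_num h ?J mu k (y \<circ> adj a) x = rest_num h I mu k a y x *
      (psi_val h ?J mu k (adj a v) a (x a - y v) * psi_val h ?J mu k (adj a v) ?b (x ?b - y v))" for x y
  proof -
    have "rest_num h ?J mu k a (y \<circ> adj a) x = rest_num h I mu k a y x"
      by (rule rest_num_adj_comp[OF I T, unfolded SJ' S]) (use v in \<open>auto simp: psi_val_off_diagonal\<close>)
    then show ?thesis
      unfolding level_num_split[of a ?J k, unfolded SJ, OF T] SJ' by simp
  qed
  \<comment> \<open>The power of hbar prescribed by \<open>p_ind\<close> makes both cases instances
    of the same identity: the factor with equal indices contains h exactly if v = a. For v = a + 1
    the arguments s and s' are shifted by -l.\<close>
  have key: "th l * th (h + X) *
        (psi_val h I mu k v a (x ?b - t) * psi_val h I mu k v ?b (x a - t)) =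
      th h * th (l - X) *
        (psi_val h I mu k v a (x a - t) * psi_val h I mu k v ?b (x ?b - t)) +
      th (h + l) * th X *
        (psi_val h ?J mu k (adj a v) a (x a - t) * psi_val h ?J mu k (adj a v) ?b (x ?b - t))" for t
    using v(1)
  proof
    assume va: "v = a"
    then have top: "I (Suc k) = ?b"
      using v by simp
    have l: "l = mu (Suc k) - mu (inv I a)"
      using inv_top by (simp add: l_def top)
    show ?thesis
      using th_three_term'[of l h "x a - t" "x ?b - t"] I
      by (simp add: va psi_val_def p_ind_def top inv_adj_comp X_def l algebra_simps)
  next
    assume "v \<in> {?b}"
    then have vb: "v = ?b" by simp
    then have top: "I (Suc k) = a"
      using v by simp
    have l: "l = mu (inv I ?b) - mu (Suc k)"
      using inv_top by (simp add: l_def top)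
    show ?thesis
      using th_three_term'[of l h "x a - t - l" "x ?b - t - l"] I
      by (simp add: vb psi_val_def p_ind_def top inv_adj_comp X_def l algebra_simps)
  qed
  have summand: "th l * th (h + X) * (level_num h I mu k y (x \<circ> adj a) / level_den h ?S y * weight h I mu Z k y) =
      th h * th (l - X) * (level_num h I mu k y x / level_den h ?S y * weight h I mu Z k y) +
      th (h + l) * th X * (level_num h ?J mu k (y \<circ> adj a) x / level_den h ?S y * weight h I mu Z k y)" for y
  proof -
    have "th l * th (h + X) * (level_num h I mu k y (x \<circ> adj a) / level_den h ?S y * weight h I mu Z k y) =
        rest_num h I mu k a y x / level_den h ?S y * weight h I mu Z k y *
        (th l * th (h + X) * (psi_val h I mu k v a (x ?b - y v) * psi_val h I mu k v ?b (x a - y v)))"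
      unfolding num rest_num_swap_columns[OF T] by simp
    then show ?thesis
      unfolding key num numJ by (simp add: algebra_simps)
  qed
  show ?thesis
    unfolding weight.simps SJ sum_assignments_adj level_den_adj[OF notboth]
      weight_relabel[OF I notboth] l_def[symmetric] X_def[symmetric]
    by (simp only: sum_distrib_left summand sum.distrib)
qed

lemma weight_exchange:
  assumes "bij I" "a \<in> I ` {1..k}" "Suc a \<in> I ` {1..k}"
    and "generic h G" "\<And>j. j < k \<Longrightarrow> Z j \<subseteq> G"
    and "th (mu (inv I (Suc a)) - mu (inv I a)) \<noteq> 0" "th (x a - x (Suc a)) \<noteq> 0"
  shows "th (mu (inv I (Suc a)) - mu (inv I a)) * th (h + (x a - x (Suc a))) * weight h I mu Z k (x \<circ> adj a) =
      th h * th (mu (inv I (Suc a)) - mu (inv I a) - (x a - x (Suc a))) * weight h I mu Z k x +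
      th (h + (mu (inv I (Suc a)) - mu (inv I a))) * th (x a - x (Suc a)) * weight h (adj a \<circ> I) mu Z k x"
  using assms
proof (induction k arbitrary: I x)
  case (Suc k)
  show ?case
  proof (cases "I (Suc k) \<in> {a, Suc a}")
    case True
    then show ?thesis
      using Suc.prems by (intro weight_exchange_start) auto
  next
    case False
    have "I ` {1..Suc k} = insert (I (Suc k)) (I ` {1..k})"
      by (simp add: atLeastAtMostSuc_conv)
    then have S: "a \<in> I ` {1..k}" "Suc a \<in> I ` {1..k}"
      using False Suc.prems(2,3) by auto
    show ?thesis
    proof (rule weight_exchange_inherit[OF Suc.prems(1) S False Suc.prems(4) _ Suc.prems(6,7)])
      show "Z k \<subseteq> G"
        by (rule Suc.prems(5)) simp
    qed (rule Suc.IH; (assumption | rule Suc.prems(4) | rule Suc.prems(5), simp))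
  qed
qed simp

end

section \<open>The restriction matrix\<close>

text \<open>An intermediate form between \<open>foldr Sym\<close> and \<open>weight\<close>: the
  variables are still indexed by ranks, but the factor of each level already stands outside the sums
  of the lower levels.\<close>

primrec nest :: "(nat \<Rightarrow> (nat \<Rightarrow> complex) \<Rightarrow> (nat \<Rightarrow> complex) \<Rightarrow> complex) \<Rightarrow> (nat \<Rightarrow> nat \<Rightarrow> complex) \<Rightarrow>
    nat \<Rightarrow> (nat \<Rightarrow> complex) \<Rightarrow> complex" where
  "nest L t 0 x = 1"
| "nest L t (Suc k) x = (\<Sum>p | p permutes {1..k}. L k (t k \<circ> p) x * nest L t k (t k \<circ> p))"

lemma nest_cong: "(\<And>j. j < k \<Longrightarrow> t j = t' j) \<Longrightarrow> nest L t k x = nest L t' k x"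
  by (induction k arbitrary: x) auto

text \<open>Symmetrizing in other levels commutes with a substitution on level j and with
  coefficients free of the symmetrized variables.\<close>

lemma foldr_Sym_sum:
  assumes "j \<notin> set ks"
    and "\<And>k p t y. k \<in> set ks \<Longrightarrow> c p (t(k := y)) = c p t"
    and "\<And>k p t y. k \<in> set ks \<Longrightarrow> f p (t(k := y)) = f p t"
  shows "foldr Sym ks (\<lambda>t. \<Sum>p\<in>A. c p t * P (t(j := f p t))) t =
    (\<Sum>p\<in>A. c p t * foldr Sym ks P (t(j := f p t)))"
  using assms
proof (induction ks arbitrary: t)
  case (Cons k ks)
  define Q where "Q = foldr Sym ks P"
  have cf: "c p (t(k := y)) = c p t" "f p (t(k := y)) = f p t" for p t y
    by (rule Cons.prems, simp)+
  have "foldr Sym ks (\<lambda>t. \<Sum>p\<in>A. c p t * P (t(j := f p t))) = (\<lambda>t. \<Sum>p\<in>A. c p t * Q (t(j := f p t)))"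
    unfolding Q_def by (intro ext Cons.IH) (use Cons.prems in auto)
  then have "foldr Sym (k # ks) (\<lambda>t. \<Sum>p\<in>A. c p t * P (t(j := f p t))) t =
      Sym k (\<lambda>t. \<Sum>p\<in>A. c p t * Q (t(j := f p t))) t"
    by simp
  also have "\<dots> = (\<Sum>p\<in>A. \<Sum>s | s permutes {1..k}. c p t * Q (t(k := t k \<circ> s, j := f p t)))"
    unfolding Sym_def cf by (rule sum.swap)
  also have "\<dots> = (\<Sum>p\<in>A. c p t * Sym k Q (t(j := f p t)))"
    unfolding Sym_def sum_distrib_left using Cons.prems(1)
    by (intro sum.cong refl) (simp add: fun_upd_twist[of j k])
  finally show ?case
    by (simp only: Q_def foldr.simps comp_apply)
qed simp

lemma foldr_Sym_upd:
  assumes "j \<notin> set ks"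
  shows "foldr Sym ks (\<lambda>t. P (t(j := z))) t = foldr Sym ks P (t(j := z))"
  using foldr_Sym_sum[OF assms, where c = "\<lambda>_ _. 1" and f = "\<lambda>_ _. z" and A = "{()}" and P = P and t = t] by simp

text \<open>The innermost symmetrization belongs to the top level and becomes the outermost sum. Its
  level factor is independent of the lower variables once the permutation is fixed, so
  \<open>foldr_Sym_sum\<close> moves the sum outside.\<close>

lemma foldr_Sym_prod_eq_nest:
  assumes "\<And>y x. L 0 y x = 1"
  shows "foldr Sym [1..<Suc m] (\<lambda>t. \<Prod>k = 1..<Suc m. L k (t k) (t (Suc k))) t = nest L t (Suc m) (t (Suc m))"
proof (induction m arbitrary: t)
  case 0
  then show ?case
    by (simp add: assms)
next
  case (Suc m)
  let ?P = "\<lambda>m t. \<Prod>k = 1..<m. L k (t k) (t (Suc k))"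
  let ?y = "\<lambda>p t. t (Suc m) \<circ> p"
  have Sym: "Sym (Suc m) (?P (Suc (Suc m))) t = (\<Sum>p | p permutes {1..Suc m}.
      L (Suc m) (?y p t) (t (Suc (Suc m))) * ?P (Suc m) (t(Suc m := ?y p t)))" for t
    unfolding Sym_def
    by (intro sum.cong refl) (simp add: prod.atLeastLessThan_Suc mult.commute)
  have IH: "foldr Sym [1..<Suc m] (?P (Suc m)) (t(Suc m := y)) = nest L t (Suc m) y" for t y
    unfolding Suc.IH fun_upd_same by (rule nest_cong) simp
  have "foldr Sym [1..<Suc (Suc m)] (?P (Suc (Suc m))) t = foldr Sym [1..<Suc m] (Sym (Suc m) (?P (Suc (Suc m)))) t"
    by simp
  also have "\<dots> = (\<Sum>p | p permutes {1..Suc m}.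
      L (Suc m) (?y p t) (t (Suc (Suc m))) * foldr Sym [1..<Suc m] (?P (Suc m)) (t(Suc m := ?y p t)))"
    unfolding Sym by (rule foldr_Sym_sum) auto
  also have "\<dots> = (\<Sum>p | p permutes {1..Suc m}.
      L (Suc m) (?y p t) (t (Suc (Suc m))) * nest L t (Suc m) (?y p t))"
    unfolding IH ..
  finally show ?case
    by simp
qed

definition rank_level :: "complex \<Rightarrow> complex \<Rightarrow> (nat \<Rightarrow> nat) \<Rightarrow> (nat \<Rightarrow> complex) \<Rightarrow> nat \<Rightarrow>
    (nat \<Rightarrow> complex) \<Rightarrow> (nat \<Rightarrow> complex) \<Rightarrow> complex" where
  "rank_level q h I mu k y x =
    (\<Prod>a = 1..k. \<Prod>c = 1..k + 1. psi q h I mu k a c (x c - y a)) /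
    (\<Prod>(a, b) \<in> {(a, b). 1 \<le> a \<and> a < b \<and> b \<le> k}. theta q (h + y a - y b) * theta q (y b - y a))"

lemma rank_level_0: "rank_level q h I mu 0 y x = 1"
proof -
  have empty: "{(a, b). 1 \<le> a \<and> a < b \<and> b \<le> (0::nat)} = {}"
    by auto
  show ?thesis
    unfolding rank_level_def empty by simp
qed

lemma W_fun_eq_nest: "W_fun n q h I t z mu = nest (rank_level q h I mu) t n z"
proof (cases n)
  case 0
  then show ?thesis
    by (simp add: W_fun_def U_fun_def)
next
  case (Suc m)
  let ?P = "\<lambda>t. \<Prod>k = 1..<n. rank_level q h I mu k (t k) (t (Suc k))"
  have "U_fun n q h I z mu t = ?P (t(n := z))" for t
  proof -
    have "{1..n - 1} = {1..<n}"
      using Suc by auto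
    then show ?thesis
      unfolding U_fun_def by (intro prod.cong) (auto simp: rank_level_def with_z_def)
  qed
  then have "W_fun n q h I t z mu = foldr Sym [1..<n] (\<lambda>t. ?P (t(n := z))) t"
    unfolding W_fun_def by (metis ext)
  also have "\<dots> = foldr Sym [1..<n] ?P (t(n := z))"
    by (rule foldr_Sym_upd) simp
  also have "\<dots> = nest (rank_level q h I mu) (t(n := z)) n z"
    unfolding Suc by (subst foldr_Sym_prod_eq_nest[where L = "rank_level q h I mu", OF rank_level_0]) simp
  also have "\<dots> = nest (rank_level q h I mu) t n z"
    by (rule nest_cong) simp
  finally show ?thesis .
qed

section \<open>Passing from ranks to values\<close>

lemma ith_bij_betw:
  assumes "inj_on I {1..k}"
  shows "bij_betw (ith I k) {1..k} (I ` {1..k})"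
proof -
  let ?l = "sorted_list_of_set (I ` {1..k})"
  have "length ?l = k"
    using assms by (simp add: card_image)
  then have "bij_betw ((!) ?l) {..<k} (I ` {1..k})"
    by (intro bij_betw_nth) auto
  moreover have "bij_betw (\<lambda>a. a - 1) {1..k} {..<k}"
    by (rule bij_betw_byWitness[where f' = Suc]) auto
  ultimately have "bij_betw ((!) ?l \<circ> (\<lambda>a. a - 1)) {1..k} (I ` {1..k})"
    by (rule bij_betw_trans[rotated])
  then show ?thesis
    by (simp add: ith_def[abs_def] o_def)
qed

lemma ith_less_iff:
  assumes "inj_on I {1..k}" "a \<in> {1..k}" "b \<in> {1..k}"
  shows "ith I k a < ith I k b \<longleftrightarrow> a < b"
proof -
  let ?l = "sorted_list_of_set (I ` {1..k})"
  have len: "length ?l = k"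
    using assms by (simp add: card_image)
  have less: "ith I k a < ith I k b" if "a < b" "a \<in> {1..k}" "b \<in> {1..k}" for a b
    unfolding ith_def using that len
    by (intro sorted_wrt_nth_less[of "(<)"]) (auto simp: strict_sorted_list_of_set)
  then show ?thesis
    using assms(2,3) by (metis linorder_neq_iff order_less_asym)
qed

lemma ith_permutes:
  assumes "I permutes {1..n}" "a \<in> {1..n}"
  shows "ith I n a = a"
proof -
  have "sorted_list_of_set {1..n} = [1..<Suc n]"
    by (simp add: atLeastLessThanSuc_atLeastAtMost[symmetric] del: upt_Suc)
  then show ?thesis
    using assms by (simp add: ith_def permutes_image del: upt_Suc)
qed

text \<open>With a fixed enumeration \<open>r\<close> of the values and \<open>\<tau>\<close> of the
  numbers, a permutation of the ranks is the same as a bijection from values to numbers.\<close>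

lemma bij_betw_permutes_assignments:
  assumes r: "bij_betw r A S" and \<tau>: "bij_betw \<tau> A Z"
  shows "bij_betw (\<lambda>p. restrict (\<tau> \<circ> p \<circ> inv_into A r) S) {p. p permutes A} (assignments S Z)"
proof (rule bij_betw_byWitness[where f' = "\<lambda>y a. if a \<in> A then inv_into A \<tau> (y (r a)) else a"])
  have r': "bij_betw (inv_into A r) S A" and \<tau>': "bij_betw (inv_into A \<tau>) Z A"
    using r \<tau> by (auto intro: bij_betw_inv_into)
  show "\<forall>p\<in>{p. p permutes A}. (\<lambda>a. if a \<in> A then inv_into A \<tau> (restrict (\<tau> \<circ> p \<circ> inv_into A r) S (r a)) else a) = p"
  proof (intro ballI ext)
    fix p a assume "p \<in> {p. p permutes A}"
    then have p: "p permutes A" by simp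
    show "(if a \<in> A then inv_into A \<tau> (restrict (\<tau> \<circ> p \<circ> inv_into A r) S (r a)) else a) = p a"
    proof (cases "a \<in> A")
      case True
      then have "p a \<in> A" "r a \<in> S"
        using p r by (auto simp: permutes_in_image bij_betw_apply)
      then show ?thesis
        using True bij_betw_inv_into_left[OF r True] bij_betw_inv_into_left[OF \<tau>, of "p a"] by simp
    next
      case False
      then show ?thesis
        using p by (simp add: permutes_not_in)
    qed
  qed
  show "\<forall>y\<in>assignments S Z. restrict (\<tau> \<circ> (\<lambda>a. if a \<in> A then inv_into A \<tau> (y (r a)) else a) \<circ> inv_into A r) S = y"
  proof (intro ballI ext)
    fix y v assume y: "y \<in> assignments S Z"
    show "restrict (\<tau> \<circ> (\<lambda>a. if a \<in> A then inv_into A \<tau> (y (r a)) else a) \<circ> inv_into A r) S v = y v"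
    proof (cases "v \<in> S")
      case True
      then have "y v \<in> Z" "inv_into A r v \<in> A"
        using y r' by (auto simp: assignments_def bij_betw_apply)
      then show ?thesis
        using True bij_betw_inv_into_right[OF r True] bij_betw_inv_into_right[OF \<tau>, of "y v"] by simp
    next
      case False
      then show ?thesis
        using y by (simp add: assignments_def extensional_def)
    qed
  qed
  show "(\<lambda>p. restrict (\<tau> \<circ> p \<circ> inv_into A r) S) ` {p. p permutes A} \<subseteq> assignments S Z"
  proof safe
    fix p assume "p permutes A"
    then have "bij_betw (\<tau> \<circ> p \<circ> inv_into A r) S Z"
      using bij_betw_trans[OF bij_betw_trans[OF r' permutes_imp_bij] \<tau>] by (simp add: comp_assoc)
    then show "restrict (\<tau> \<circ> p \<circ> inv_into A r) S \<in> assignments S Z"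
      by (simp add: assignments_def bij_betw_restrict_eq)
  qed
  show "(\<lambda>y a. if a \<in> A then inv_into A \<tau> (y (r a)) else a) ` assignments S Z \<subseteq> {p. p permutes A}"
  proof safe
    fix y assume "y \<in> assignments S Z"
    then have "bij_betw (inv_into A \<tau> \<circ> (y \<circ> r)) A A"
      using bij_betw_trans[OF bij_betw_trans[OF r] \<tau>'] by (simp add: assignments_def)
    then have "bij_betw (\<lambda>a. if a \<in> A then inv_into A \<tau> (y (r a)) else a) A A"
      by (rule bij_betw_cong[THEN iffD1, rotated]) simp
    then show "(\<lambda>a. if a \<in> A then inv_into A \<tau> (y (r a)) else a) permutes A"
      by (rule bij_imp_permutes) simp
  qed
qed

context nome
begin

lemma rank_level_eq:
  assumes I: "inj I"
    and x: "\<And>c. c \<in> {1..Suc k} \<Longrightarrow> x' (ith I (Suc k) c) = x c"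
    and y: "\<And>a. a \<in> {1..k} \<Longrightarrow> y' (ith I k a) = y a"
  shows "rank_level q h I mu k y x = level_num h I mu k y' x' / level_den h (I ` {1..k}) y'"
proof -
  have inj: "inj_on I A" for A
    using I by (rule inj_on_subset) simp
  let ?r = "ith I k" and ?r' = "ith I (Suc k)" and ?S = "I ` {1..k}"
  note r = ith_bij_betw[OF inj, of k] and r' = ith_bij_betw[OF inj, of "Suc k"]
  have "(\<Prod>a = 1..k. \<Prod>c = 1..k + 1. psi q h I mu k a c (x c - y a)) =
      (\<Prod>a = 1..k. \<Prod>c = 1..Suc k. psi_val h I mu k (?r a) (?r' c) (x' (?r' c) - y' (?r a)))"
    by (intro prod.cong) (auto simp: psi_def psi_val_def x y)
  also have "\<dots> = (\<Prod>a = 1..k. \<Prod>c\<in>I ` {1..Suc k}. psi_val h I mu k (?r a) c (x' c - y' (?r a)))"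
    by (rule prod.cong[OF refl], rule prod.reindex_bij_betw[OF r'])
  also have "\<dots> = level_num h I mu k y' x'"
    unfolding level_num_def Suc_eq_plus1[symmetric] by (rule prod.reindex_bij_betw[OF r])
  finally have num: "(\<Prod>a = 1..k. \<Prod>c = 1..k + 1. psi q h I mu k a c (x c - y a)) = level_num h I mu k y' x'" .
  have "bij_betw (map_prod ?r ?r) {(a, b). 1 \<le> a \<and> a < b \<and> b \<le> k} {(v, w). v \<in> ?S \<and> w \<in> ?S \<and> v < w}"
  proof (rule bij_betw_imageI)
    show "inj_on (map_prod ?r ?r) {(a, b). 1 \<le> a \<and> a < b \<and> b \<le> k}"
      by (rule inj_on_subset[OF map_prod_inj_on[OF bij_betw_imp_inj_on[OF r] bij_betw_imp_inj_on[OF r]]]) auto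
    show "map_prod ?r ?r ` {(a, b). 1 \<le> a \<and> a < b \<and> b \<le> k} = {(v, w). v \<in> ?S \<and> w \<in> ?S \<and> v < w}"
    proof (intro equalityI subsetI)
      fix p assume "p \<in> map_prod ?r ?r ` {(a, b). 1 \<le> a \<and> a < b \<and> b \<le> k}"
      then obtain a b where "p = (?r a, ?r b)" "a \<in> {1..k}" "b \<in> {1..k}" "a < b"
        by auto
      then show "p \<in> {(v, w). v \<in> ?S \<and> w \<in> ?S \<and> v < w}"
        using ith_less_iff[OF inj, of a k b] bij_betw_apply[OF r] by auto
    next
      fix p assume "p \<in> {(v, w). v \<in> ?S \<and> w \<in> ?S \<and> v < w}"
      then obtain a b where "p = (?r a, ?r b)" "a \<in> {1..k}" "b \<in> {1..k}" "?r a < ?r b"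
        using bij_betw_imp_surj_on[OF r, symmetric] by auto
      then show "p \<in> map_prod ?r ?r ` {(a, b). 1 \<le> a \<and> a < b \<and> b \<le> k}"
        using ith_less_iff[OF inj, of a k b] by (intro image_eqI[of _ _ "(a, b)"]) auto
    qed
  qed
  from prod.reindex_bij_betw[OF this, of "\<lambda>(v, w). th (h + y' v - y' w) * th (y' w - y' v)"]
  have "level_den h ?S y' = (\<Prod>(a, b) \<in> {(a, b). 1 \<le> a \<and> a < b \<and> b \<le> k}.
      th (h + y' (?r a) - y' (?r b)) * th (y' (?r b) - y' (?r a)))"
    by (simp add: level_den_def case_prod_unfold)
  also have "\<dots> = (\<Prod>(a, b) \<in> {(a, b). 1 \<le> a \<and> a < b \<and> b \<le> k}. th (h + y a - y b) * th (y b - y a))"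
    by (intro prod.cong) (auto simp: y)
  finally show ?thesis
    unfolding rank_level_def num by simp
qed

lemma nest_eq_weight:
  assumes I: "inj I"
    and t: "\<And>j. j < k \<Longrightarrow> bij_betw (t j) {1..j} (Z j)"
    and x: "\<And>a. a \<in> {1..k} \<Longrightarrow> x' (ith I k a) = x a"
  shows "nest (rank_level q h I mu) t k x = weight h I mu Z k x'"
  using t x
proof (induction k arbitrary: x x')
  case (Suc k)
  have inj: "inj_on I A" for A
    using I by (rule inj_on_subset) simp
  let ?r = "ith I k" and ?S = "I ` {1..k}"
  define y where "y p = restrict (t k \<circ> p \<circ> inv_into {1..k} ?r) ?S" for p
  note r = ith_bij_betw[OF inj, of k]
  have y: "y p (?r a) = (t k \<circ> p) a" if "a \<in> {1..k}" for p a
    using that bij_betw_apply[OF r that] bij_betw_inv_into_left[OF r that] by (simp add: y_def)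
  have "bij_betw y {p. p permutes {1..k}} (assignments ?S (Z k))"
    unfolding y_def by (rule bij_betw_permutes_assignments[OF r]) (use Suc.prems(1) in simp)
  then have "weight h I mu Z (Suc k) x' = (\<Sum>p | p permutes {1..k}.
      level_num h I mu k (y p) x' / level_den h ?S (y p) * weight h I mu Z k (y p))"
    unfolding weight.simps by (rule sum.reindex_bij_betw[symmetric])
  also have "\<dots> = (\<Sum>p | p permutes {1..k}.
      rank_level q h I mu k (t k \<circ> p) x * nest (rank_level q h I mu) t k (t k \<circ> p))"
  proof (intro sum.cong refl arg_cong2[where f = "(*)"])
    fix p
    show "level_num h I mu k (y p) x' / level_den h ?S (y p) = rank_level q h I mu k (t k \<circ> p) x"
      by (rule rank_level_eq[OF I, symmetric]) (use Suc.prems(2) y in auto)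
    show "weight h I mu Z k (y p) = nest (rank_level q h I mu) t k (t k \<circ> p)"
      by (rule Suc.IH[symmetric]) (use Suc.prems(1) y in auto)
  qed
  finally show ?case
    by simp
qed simp

text \<open>Injectivity of z keeps the sets at their full size; with coinciding coordinates there
  would be no bijections onto them.\<close>

lemma A_mat_eq_weight:
  assumes "I permutes {1..n}" "J permutes {1..n}" "inj_on z {1..n}"
  shows "A_mat n q h I J z mu = weight h I mu (\<lambda>k. z ` J ` {1..k}) n z"
  unfolding A_mat_def W_fun_eq_nest
proof (rule nest_eq_weight)
  show "inj I"
    using assms(1) by (rule permutes_inj)
  fix j assume "j < n"
  then have "J ` {1..j} \<subseteq> {1..n}"
    using image_mono[of "{1..j}" "{1..n}" J] permutes_image[OF assms(2)] by auto
  then have "bij_betw z (J ` {1..j}) (z ` J ` {1..j})"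
    using assms(3) by (meson inj_on_imp_bij_betw inj_on_subset)
  then have "bij_betw (z \<circ> ith J j) {1..j} (z ` J ` {1..j})"
    by (intro bij_betw_trans[OF ith_bij_betw]) (auto intro: permutes_inj_on[OF assms(2)])
  then show "bij_betw (z_subst J z j) {1..j} (z ` J ` {1..j})"
    by (simp add: z_subst_def[abs_def] o_def)
qed (use ith_permutes[OF assms(1)] in simp)

section \<open>Generic points and the exchange relation for the matrix\<close>

definition generic_seq :: "complex \<Rightarrow> nat \<Rightarrow> (nat \<Rightarrow> complex) \<Rightarrow> bool" where
  "generic_seq h n z \<longleftrightarrow> (\<forall>i\<in>{1..n}. \<forall>j\<in>{1..n}. i \<noteq> j \<longrightarrow> th (z i - z j) \<noteq> 0 \<and> th (h + (z i - z j)) \<noteq> 0)"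

lemma generic_seqD:
  assumes "generic_seq h n z" "i \<in> {1..n}" "j \<in> {1..n}" "i \<noteq> j"
  shows "th (z i - z j) \<noteq> 0" "th (h + (z i - z j)) \<noteq> 0"
  using assms by (auto simp: generic_seq_def)

lemma generic_seq_inj_on: "generic_seq h n z \<Longrightarrow> inj_on z {1..n}"
  unfolding inj_on_def generic_seq_def by (metis diff_self th_0)

lemma generic_seq_generic: "generic_seq h n z \<Longrightarrow> generic h (z ` {1..n})"
  by (auto simp: generic_seq_def generic_def)

lemma generic_seq_permutes:
  assumes "generic_seq h n z" "p permutes {1..n}"
  shows "generic_seq h n (z \<circ> p)"
  unfolding generic_seq_def comp_apply
proof (intro ballI impI conjI)
  fix i j assume "i \<in> {1..n}" "j \<in> {1..n}" "i \<noteq> j"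
  then have "p i \<in> {1..n}" "p j \<in> {1..n}" "p i \<noteq> p j"
    using permutes_in_image[OF assms(2)] permutes_inj[OF assms(2)] by (auto simp only: inj_eq)
  then show "th (z (p i) - z (p j)) \<noteq> 0" "th (h + (z (p i) - z (p j))) \<noteq> 0"
    by (rule generic_seqD[OF assms(1)])+
qed

lemma generic_seq_minus:
  assumes "generic_seq h n z"
  shows "generic_seq h n (\<lambda>i. - z i)"
proof -
  have "- z i - - z j = z j - z i" for i j
    by simp
  then show ?thesis
    using generic_seqD[OF assms] unfolding generic_seq_def by simp
qed

lemma adj_permutes: "1 \<le> a \<Longrightarrow> a < n \<Longrightarrow> adj a permutes {1..n}"
  by (rule permutes_swap_id) auto

text \<open>Swapping z_a, z_(a+1) and at the same time the values a, a + 1 of J leaves every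
  substituted set unchanged. Only the argument on the top level is swapped, as in
  \<open>weight_exchange\<close>.\<close>

lemma A_mat_exchange:
  assumes I: "I permutes {1..n}" and J: "J permutes {1..n}" and a: "1 \<le> a" "a < n"
    and z: "generic_seq h n z" and mu: "generic_seq h n mu"
  defines "l \<equiv> mu (inv I (Suc a)) - mu (inv I a)"
  shows "th l * th (h + (z a - z (Suc a))) * A_mat n q h I (adj a \<circ> J) (z \<circ> adj a) mu =
    th h * th (l - (z a - z (Suc a))) * A_mat n q h I J z mu +
    th (h + l) * th (z a - z (Suc a)) * A_mat n q h (adj a \<circ> I) J z mu"
proof -
  note adj = adj_permutes[OF a]
  have mem: "a \<in> {1..n}" "Suc a \<in> {1..n}"
    using a by auto
  have "A_mat n q h I (adj a \<circ> J) (z \<circ> adj a) mu =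
      weight h I mu (\<lambda>k. (z \<circ> adj a) ` (adj a \<circ> J) ` {1..k}) n (z \<circ> adj a)"
    by (intro A_mat_eq_weight I permutes_compose[OF J adj] generic_seq_inj_on[OF generic_seq_permutes[OF z adj]])
  also have "(\<lambda>k. (z \<circ> adj a) ` (adj a \<circ> J) ` {1..k}) = (\<lambda>k. z ` J ` {1..k})"
    by (simp add: image_image)
  finally have 1: "A_mat n q h I (adj a \<circ> J) (z \<circ> adj a) mu = weight h I mu (\<lambda>k. z ` J ` {1..k}) n (z \<circ> adj a)" .
  have inv: "inv I a \<in> {1..n}" "inv I (Suc a) \<in> {1..n}" "inv I (Suc a) \<noteq> inv I a"
    using mem permutes_in_image[OF permutes_inv[OF I]] inj_eq[OF permutes_inj[OF permutes_inv[OF I]]] by auto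
  show ?thesis
    unfolding 1 A_mat_eq_weight[OF I J generic_seq_inj_on[OF z]]
      A_mat_eq_weight[OF permutes_compose[OF I adj] J generic_seq_inj_on[OF z]] l_def
  proof (rule weight_exchange)
    show "bij I"
      by (rule permutes_bij[OF I])
    show "a \<in> I ` {1..n}" "Suc a \<in> I ` {1..n}"
      by (simp_all only: permutes_image[OF I] mem)
    show "generic h (z ` {1..n})"
      by (rule generic_seq_generic[OF z])
    show "z ` J ` {1..j} \<subseteq> z ` {1..n}" if "j < n" for j
      using that image_mono[of "{1..j}" "{1..n}" J] permutes_image[OF J] by auto
    show "th (mu (inv I (Suc a)) - mu (inv I a)) \<noteq> 0"
      using generic_seqD(1)[OF mu inv(2,1,3)] .
    show "th (z a - z (Suc a)) \<noteq> 0"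
      using generic_seqD(1)[OF z mem] by simp
  qed
qed

end

section \<open>Triangularity\<close>

lemma prod_off_diagonal:
  fixes g :: "nat \<Rightarrow> nat \<Rightarrow> complex"
  assumes "finite S"
  shows "(\<Prod>v\<in>S. \<Prod>c\<in>S - {v}. g v c) = (\<Prod>(v, w) | v \<in> S \<and> w \<in> S \<and> v < w. g w v * g v w)"
proof -
  let ?P = "{(v, w). v \<in> S \<and> w \<in> S \<and> v < w}"
  have "(\<Prod>v\<in>S. \<Prod>c\<in>S - {v}. g v c) = (\<Prod>(v, c)\<in>Sigma S (\<lambda>v. S - {v}). g v c)"
    using assms by (intro prod.Sigma) auto
  also have "Sigma S (\<lambda>v. S - {v}) = prod.swap ` ?P \<union> ?P"
    by (auto simp: image_iff)
  also have "(\<Prod>(v, c)\<in>prod.swap ` ?P \<union> ?P. g v c) =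
      (\<Prod>(v, c)\<in>prod.swap ` ?P. g v c) * (\<Prod>(v, c)\<in>?P. g v c)"
    using finite_pairs[OF assms] by (intro prod.union_disjoint) auto
  also have "(\<Prod>(v, c)\<in>prod.swap ` ?P. g v c) = (\<Prod>(v, w)\<in>?P. g w v)"
    by (subst prod.reindex) (auto simp: case_prod_unfold)
  finally show ?thesis
    by (simp add: case_prod_unfold prod.distrib)
qed

lemma prod_triangle:
  fixes g :: "nat \<Rightarrow> nat \<Rightarrow> complex"
  shows "(\<Prod>k<n. \<Prod>j = 1..k. g j (Suc k)) = (\<Prod>(v, w) | v \<in> {1..n} \<and> w \<in> {1..n} \<and> v < w. g v w)"
proof -
  have "(\<Prod>k<n. \<Prod>j = 1..k. g j (Suc k)) = (\<Prod>(k, j)\<in>Sigma {..<n} (\<lambda>k. {1..k}). g j (Suc k))"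
    by (rule prod.Sigma) auto
  also have "\<dots> = (\<Prod>(v, w) | v \<in> {1..n} \<and> w \<in> {1..n} \<and> v < w. g v w)"
    by (rule prod.reindex_bij_witness[where i = "\<lambda>(v, w). (w - 1, v)" and j = "\<lambda>(k, j). (j, Suc k)"]) auto
  finally show ?thesis .
qed

definition pair_prod :: "nat \<Rightarrow> (complex \<Rightarrow> complex) \<Rightarrow> (nat \<Rightarrow> complex) \<Rightarrow> complex" where
  "pair_prod n g z = (\<Prod>(v, w) | v \<in> {1..n} \<and> w \<in> {1..n} \<and> v < w. g (z v - z w))"

lemma pair_prod_adj:
  assumes "1 \<le> a" "a < n"
  shows "pair_prod n g (z \<circ> adj a) * g (z a - z (Suc a)) = pair_prod n g z * g (z (Suc a) - z a)"
proof -
  let ?P = "{(v, w). v \<in> {1..n} \<and> w \<in> {1..n} \<and> v < w}"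
  have mem: "a \<in> {1..n}" "Suc a \<in> {1..n}" "(a, Suc a) \<in> ?P"
    using assms by auto
  have "pair_prod n g x = g (x a - x (Suc a)) * (\<Prod>(v, w)\<in>?P - {(a, Suc a)}. g (x v - x w))" for x
    unfolding pair_prod_def by (subst prod.remove[OF finite_pairs mem(3)]) auto
  then show ?thesis
    using prod_pairs_adj[OF mem(1,2), of "\<lambda>v w. g (z v - z w)"] by simp
qed

lemma longest_longest [simp]: "longest n (longest n k) = k"
  by (auto simp: longest_def)

lemma inv_longest: "inv (longest n) = longest n"
  by (rule inv_unique_comp) (auto simp: fun_eq_iff)

lemma prod_pairs_longest:
  fixes g :: "nat \<Rightarrow> nat \<Rightarrow> complex"
  shows "(\<Prod>(v, w) | v \<in> {1..n} \<and> w \<in> {1..n} \<and> v < w. g (longest n w) (longest n v)) =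
    (\<Prod>(v, w) | v \<in> {1..n} \<and> w \<in> {1..n} \<and> v < w. g v w)"
  by (rule prod.reindex_bij_witness[where i = "\<lambda>(v, w). (longest n w, longest n v)"
        and j = "\<lambda>(v, w). (longest n w, longest n v)"]) (auto simp: longest_def)

lemma prod_pairs_minus_one:
  "(\<Prod>(v, w) | v \<in> {1..n} \<and> w \<in> {1..n} \<and> v < w. - 1) = (- 1 :: complex) ^ (n * (n - 1) div 2)"
proof -
  have "(\<Prod>(v, w) | v \<in> {1..n} \<and> w \<in> {1..n} \<and> v < w. - 1) = (\<Prod>k<n. \<Prod>j = 1..k. (- 1 :: complex))"
    using prod_triangle[of "\<lambda>_ _. - 1" n] by simp
  also have "\<dots> = (- 1) ^ (\<Sum>k<n. k)"
    by (simp add: power_sum)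
  also have "(\<Sum>k<n. k) = n * (n - 1) div 2"
    using Sum_Ico_nat[of 0 n] by (simp add: atLeast0LessThan)
  finally show ?thesis .
qed

context nome
begin

text \<open>The contribution of level k to the summand that assigns z_v to each value v, after
  cancellation with the denominator. For each j it consists of the factor in the new column I(k + 1)
  and the factor with equal indices.\<close>

definition diag_level :: "complex \<Rightarrow> (nat \<Rightarrow> nat) \<Rightarrow> (nat \<Rightarrow> complex) \<Rightarrow> (nat \<Rightarrow> complex) \<Rightarrow> nat \<Rightarrow> complex" where
  "diag_level h I mu z k = (\<Prod>j = 1..k.
     if I (Suc k) < I j then th (h + (z (I (Suc k)) - z (I j))) * th (mu (Suc k) - mu j)
     else th (z (I (Suc k)) - z (I j)) * th (h + (mu (Suc k) - mu j)))"

text \<open>When both levels are evaluated at z, the numerator factors with distinct indices among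
  I(1), ..., I(k) form exactly the denominator: each pair contributes one theta with h and one
  without.\<close>

lemma level_diagonal:
  assumes I: "I permutes {1..n}" and k: "k < n" and z: "generic_seq h n z"
    and x: "\<And>v. v \<in> I ` {1..Suc k} \<Longrightarrow> x v = z v" and y: "\<And>v. v \<in> I ` {1..k} \<Longrightarrow> y v = z v"
  shows "level_num h I mu k y x / level_den h (I ` {1..k}) y = diag_level h I mu z k"
proof -
  let ?S = "I ` {1..k}" and ?i = "I (Suc k)"
  let ?f = "\<lambda>v c. psi_val h I mu k v c (z c - z v)"
  have inj: "inj I"
    by (rule permutes_inj[OF I])
  have T: "I ` {1..k + 1} = insert ?i ?S" and notin: "?i \<notin> ?S"
    using inj by (auto simp: atLeastAtMostSuc_conv inj_image_mem_iff)
  have sub: "?S \<subseteq> {1..n}"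
    using k image_mono[of "{1..k}" "{1..n}" I] permutes_image[OF I] by auto
  have "level_den h ?S y = (\<Prod>(v, w) | v \<in> ?S \<and> w \<in> ?S \<and> v < w. th (h + (z v - z w)) * th (z w - z v))"
    unfolding level_den_def by (intro prod.cong) (auto simp: y algebra_simps)
  also have "\<dots> = (\<Prod>(v, w) | v \<in> ?S \<and> w \<in> ?S \<and> v < w. ?f w v * ?f v w)"
    by (intro prod.cong) (auto simp: psi_val_def)
  also have "\<dots> = (\<Prod>v\<in>?S. \<Prod>c\<in>?S - {v}. ?f v c)"
    by (rule prod_off_diagonal[symmetric]) simp
  finally have den: "level_den h ?S y = (\<Prod>v\<in>?S. \<Prod>c\<in>?S - {v}. ?f v c)" .
  have "?f v c \<noteq> 0" if "v \<in> ?S" "c \<in> ?S - {v}" for v c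
  proof -
    have "c \<in> {1..n}" "v \<in> {1..n}" "c \<noteq> v"
      using that sub by auto
    from generic_seqD[OF z this] show ?thesis
      using \<open>c \<noteq> v\<close> by (simp add: psi_val_def)
  qed
  then have nz: "(\<Prod>v\<in>?S. \<Prod>c\<in>?S - {v}. ?f v c) \<noteq> 0"
    by (simp only: prod_zero_iff finite_imageI finite_atLeastAtMost finite_Diff) blast
  have "level_num h I mu k y x = (\<Prod>v\<in>?S. \<Prod>c\<in>insert ?i ?S. ?f v c)"
    unfolding level_num_def T by (intro prod.cong refl) (use x y T in auto)
  also have "\<dots> = (\<Prod>v\<in>?S. (?f v ?i * ?f v v) * (\<Prod>c\<in>?S - {v}. ?f v c))"
  proof (rule prod.cong[OF refl])
    fix v assume v: "v \<in> ?S"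
    have "(\<Prod>c\<in>insert ?i ?S. ?f v c) = ?f v ?i * (\<Prod>c\<in>?S. ?f v c)"
      by (rule prod.insert[OF _ notin]) simp
    also have "(\<Prod>c\<in>?S. ?f v c) = ?f v v * (\<Prod>c\<in>?S - {v}. ?f v c)"
      by (rule prod.remove[OF _ v]) simp
    finally show "(\<Prod>c\<in>insert ?i ?S. ?f v c) = ?f v ?i * ?f v v * (\<Prod>c\<in>?S - {v}. ?f v c)"
      by (simp only: mult.assoc)
  qed
  also have "\<dots> = (\<Prod>v\<in>?S. ?f v ?i * ?f v v) * level_den h ?S y"
    unfolding den by (rule prod.distrib)
  finally have "level_num h I mu k y x / level_den h ?S y = (\<Prod>v\<in>?S. ?f v ?i * ?f v v)"
    using nz unfolding den by simp
  also have "\<dots> = (\<Prod>j = 1..k. ?f (I j) ?i * ?f (I j) (I j))"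
    by (rule prod.reindex_cong[of I]) (use inj in \<open>auto intro: inj_on_subset\<close>)
  also have "\<dots> = diag_level h I mu z k"
    unfolding diag_level_def
  proof (rule prod.cong[OF refl])
    fix j assume "j \<in> {1..k}"
    then have "I j \<in> ?S"
      by (rule imageI)
    then have "?i \<noteq> I j"
      using notin by metis
    then show "?f (I j) ?i * ?f (I j) (I j) =
        (if ?i < I j then th (h + (z ?i - z (I j))) * th (mu (Suc k) - mu j)
         else th (z ?i - z (I j)) * th (h + (mu (Suc k) - mu j)))"
      using inv_f_f[OF inj, of j] by (simp add: psi_val_def p_ind_def add_diff_eq)
  qed
  finally show ?thesis .
qed

text \<open>A nonzero summand requires \<open>y v = z (f v)\<close> with \<open>f v \<le> v\<close> for a bijection \<open>f\<close> from
  \<open>{I\<^sub>1, \<dots>, I\<^sub>k}\<close> to \<open>{J\<^sub>1, \<dots>, J\<^sub>k}\<close>; comparing the sums of both sets shows that \<open>f\<close> is the identity.\<close>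

lemma level_num_triangular:
  assumes I: "I permutes {1..n}" and J: "J permutes {1..n}" and k: "k < n" and z: "generic_seq h n z"
    and T: "I ` {1..Suc k} = J ` {1..Suc k}" and le: "J (Suc k) \<le> I (Suc k)"
    and x: "\<And>v. v \<in> I ` {1..Suc k} \<Longrightarrow> x v = z v"
    and y: "y \<in> assignments (I ` {1..k}) (z ` J ` {1..k})" and nz: "level_num h I mu k y x \<noteq> 0"
  shows "I (Suc k) = J (Suc k) \<and> y = restrict z (I ` {1..k})"
proof -
  let ?S = "I ` {1..k}" and ?T = "J ` {1..k}"
  have TI: "I ` {1..Suc k} = insert (I (Suc k)) ?S" "I (Suc k) \<notin> ?S"
    using permutes_inj[OF I] by (auto simp: atLeastAtMostSuc_conv inj_image_mem_iff)
  have TJ: "J ` {1..Suc k} = insert (J (Suc k)) ?T" "J (Suc k) \<notin> ?T"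
    using permutes_inj[OF J] by (auto simp: atLeastAtMostSuc_conv inj_image_mem_iff)
  have sub: "?T \<subseteq> {1..n}"
    using k image_mono[of "{1..k}" "{1..n}" J] permutes_image[OF J] by auto
  have "bij_betw z ?T (z ` ?T)"
    using generic_seq_inj_on[OF z] sub by (meson inj_on_imp_bij_betw inj_on_subset)
  then have zT: "bij_betw (inv_into ?T z) (z ` ?T) ?T"
    by (rule bij_betw_inv_into)
  define f where "f = inv_into ?T z \<circ> y"
  have f: "bij_betw f ?S ?T"
    unfolding f_def using y zT by (auto simp: assignments_def intro: bij_betw_trans)
  have zf: "z (f v) = y v" if "v \<in> ?S" for v
    using y that unfolding f_def assignments_def comp_apply by (intro f_inv_into_f) (auto simp: bij_betw_def)
  have f_le: "f v \<le> v" if v: "v \<in> ?S" for v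
  proof (rule ccontr)
    assume "\<not> f v \<le> v"
    have fv: "f v \<in> I ` {1..k + 1}"
      using bij_betw_apply[OF f v] T TJ by auto
    \<comment> \<open>For c > v the factor is theta of the plain difference, and here that
      difference is z(f v) - y(v) = 0.\<close>
    then have "psi_val h I mu k v (f v) (x (f v) - y v) = 0"
      using \<open>\<not> f v \<le> v\<close> x[of "f v"] zf[OF v] by (simp add: psi_val_def)
    then have "(\<Prod>c\<in>I ` {1..k + 1}. psi_val h I mu k v c (x c - y v)) = 0"
      using fv by (intro prod_zero) auto
    then have "level_num h I mu k y x = 0"
      unfolding level_num_def using v by (intro prod_zero) auto
    with nz show False ..
  qed
  have "I (Suc k) + \<Sum>?S = J (Suc k) + \<Sum>?T"
    using arg_cong[OF T, of Sum] TI TJ by simp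
  moreover have "\<Sum>?T = (\<Sum>v\<in>?S. f v)"
    using sum.reindex_bij_betw[OF f, of "\<lambda>v. v"] by simp
  moreover have "(\<Sum>v\<in>?S. f v) \<le> \<Sum>?S"
    by (rule sum_mono) (rule f_le)
  ultimately have eq: "I (Suc k) = J (Suc k)" "(\<Sum>v\<in>?S. f v) = \<Sum>?S"
    using le by linarith+
  have "f v = v" if "v \<in> ?S" for v
    by (rule sum_mono_inv[OF eq(2) f_le that]) auto
  then have "y v = restrict z ?S v" for v
    using zf[of v] y by (cases "v \<in> ?S") (auto simp: assignments_def extensional_def)
  then show ?thesis
    using eq(1) by auto
qed

text \<open>Starting from equal sets on the top level, a nonzero summand forces I and J to agree at
  position k + 1, hence the sets to agree one level down. The condition \<open>tri\<close> holds in
  both extreme cases: each entry of the longest permutation is the least among those up to it, and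
  each entry of the identity is the greatest.\<close>

lemma weight_triangular:
  assumes I: "I permutes {1..n}" and J: "J permutes {1..n}" and z: "generic_seq h n z"
    and tri: "\<And>k. k < n \<Longrightarrow> I ` {1..Suc k} = J ` {1..Suc k} \<Longrightarrow> J (Suc k) \<le> I (Suc k)"
    and "k \<le> n" "I ` {1..k} = J ` {1..k}" "\<And>v. v \<in> I ` {1..k} \<Longrightarrow> x v = z v"
  shows "weight h I mu (\<lambda>k. z ` J ` {1..k}) k x =
    (if \<forall>j\<in>{1..k}. I j = J j then \<Prod>j<k. diag_level h I mu z j else 0)"
  using assms(5-)
proof (induction k arbitrary: x)
  case (Suc k)
  let ?S = "I ` {1..k}" and ?Z = "\<lambda>k. z ` J ` {1..k}"
  let ?t = "\<lambda>y. level_num h I mu k y x / level_den h ?S y * weight h I mu ?Z k y"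
  have k: "k < n"
    using Suc.prems by simp
  have tr: "I (Suc k) = J (Suc k) \<and> y = restrict z ?S"
    if "y \<in> assignments ?S (?Z k)" "level_num h I mu k y x \<noteq> 0" for y
    by (rule level_num_triangular[OF I J k z Suc.prems(2) tri[OF k Suc.prems(2)] Suc.prems(3) that])
  have all: "(\<forall>j\<in>{1..Suc k}. I j = J j) \<longleftrightarrow> (\<forall>j\<in>{1..k}. I j = J j) \<and> I (Suc k) = J (Suc k)"
    by (auto simp: atLeastAtMostSuc_conv)
  show ?case
  proof (cases "I (Suc k) = J (Suc k)")
    case False
    then have "?t y = 0" if "y \<in> assignments ?S (?Z k)" for y
      using tr[OF that] by force
    then show ?thesis
      using False unfolding weight.simps all by (simp add: sum.neutral)
  next
    case True
    have "inj I" "inj J"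
      by (rule permutes_inj[OF I], rule permutes_inj[OF J])
    then have "?S = I ` {1..Suc k} - {I (Suc k)}" "J ` {1..k} = J ` {1..Suc k} - {J (Suc k)}"
      by (auto simp: atLeastAtMostSuc_conv inj_image_mem_iff)
    then have ST: "?S = J ` {1..k}"
      using Suc.prems(2) True by simp
    have "?S \<subseteq> {1..n}"
      using k image_mono[of "{1..k}" "{1..n}" I] permutes_image[OF I] by auto
    then have "bij_betw z ?S (z ` ?S)"
      using generic_seq_inj_on[OF z] by (meson inj_on_imp_bij_betw inj_on_subset)
    then have mem: "restrict z ?S \<in> assignments ?S (?Z k)"
      unfolding ST[symmetric] by (simp add: assignments_def bij_betw_restrict_eq)
    have "finite (assignments ?S (?Z k))"
      by (rule finite_assignments) auto
    then have "(\<Sum>y\<in>assignments ?S (?Z k). ?t y) = (\<Sum>y\<in>{restrict z ?S}. ?t y)"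
      using mem tr by (intro sum.mono_neutral_right) force+
    also have "\<dots> = diag_level h I mu z k * weight h I mu ?Z k (restrict z ?S)"
      using level_diagonal[OF I k z Suc.prems(3), of "restrict z ?S" mu] by simp
    also have "weight h I mu ?Z k (restrict z ?S) = (if \<forall>j\<in>{1..k}. I j = J j then \<Prod>j<k. diag_level h I mu z j else 0)"
      by (rule Suc.IH) (use k ST in auto)
    finally show ?thesis
      using True unfolding weight.simps all by (simp add: mult.commute)
  qed
qed simp

lemma A_mat_triangular:
  assumes I: "I permutes {1..n}" and J: "J permutes {1..n}" and z: "generic_seq h n z"
    and tri: "\<And>k. k < n \<Longrightarrow> I ` {1..Suc k} = J ` {1..Suc k} \<Longrightarrow> J (Suc k) \<le> I (Suc k)"
  shows "A_mat n q h I J z mu = (if I = J then \<Prod>k<n. diag_level h I mu z k else 0)"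
proof -
  have "(\<forall>j\<in>{1..n}. I j = J j) \<longleftrightarrow> I = J"
    using I J unfolding fun_eq_iff by (metis permutes_not_in)
  moreover have "I ` {1..n} = J ` {1..n}"
    by (simp only: permutes_image[OF I] permutes_image[OF J])
  ultimately show ?thesis
    unfolding A_mat_eq_weight[OF I J generic_seq_inj_on[OF z]]
    using weight_triangular[OF I J z tri, of n z mu] by simp
qed

lemma A_mat_longest:
  assumes I: "I permutes {1..n}" and z: "generic_seq h n z"
  shows "A_mat n q h I (longest n) z mu =
    (if I = longest n then pair_prod n (\<lambda>u. th (h + u)) z * pair_prod n (\<lambda>u. th (- u)) mu else 0)"
proof -
  have "longest n (Suc k) \<le> I (Suc k)" if "k < n" "I ` {1..Suc k} = longest n ` {1..Suc k}" for k
  proof -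
    have "I (Suc k) \<in> longest n ` {1..Suc k}"
      unfolding that(2)[symmetric] by (rule imageI) simp
    then show ?thesis
      using that(1) by (auto simp: longest_def)
  qed
  moreover have "(\<Prod>k<n. diag_level h (longest n) mu z k) = (\<Prod>k<n. \<Prod>j = 1..k.
      th (h + (z (longest n (Suc k)) - z (longest n j))) * th (mu (Suc k) - mu j))"
    unfolding diag_level_def by (intro prod.cong) (auto simp: longest_def)
  moreover have "\<dots> = (\<Prod>(v, w) | v \<in> {1..n} \<and> w \<in> {1..n} \<and> v < w.
      th (h + (z (longest n w) - z (longest n v))) * th (mu w - mu v))"
    by (rule prod_triangle)
  moreover have "\<dots> = pair_prod n (\<lambda>u. th (h + u)) z * pair_prod n (\<lambda>u. th (- u)) mu"
    using prod_pairs_longest[of "\<lambda>v w. th (h + (z v - z w))" n]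
    by (simp add: case_prod_unfold prod.distrib pair_prod_def)
  ultimately show ?thesis
    using A_mat_triangular[OF I longest_permutes z] by presburger
qed

lemma A_mat_id:
  assumes J: "J permutes {1..n}" and z: "generic_seq h n z"
  shows "A_mat n q h id J z mu =
    (if J = id then pair_prod n (\<lambda>u. th (- u)) z * pair_prod n (\<lambda>u. th (h - u)) mu else 0)"
proof -
  have "J (Suc k) \<le> id (Suc k)" if "id ` {1..Suc k} = J ` {1..Suc k}" for k
  proof -
    have "J (Suc k) \<in> J ` {1..Suc k}"
      by (rule imageI) simp
    then show ?thesis
      unfolding that[symmetric] by simp
  qed
  moreover have "(\<Prod>k<n. diag_level h id mu z k) = (\<Prod>k<n. \<Prod>j = 1..k. th (z (Suc k) - z j) * th (h + (mu (Suc k) - mu j)))"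
    unfolding diag_level_def by (intro prod.cong) auto
  moreover have "\<dots> = (\<Prod>(v, w) | v \<in> {1..n} \<and> w \<in> {1..n} \<and> v < w. th (z w - z v) * th (h + (mu w - mu v)))"
    by (rule prod_triangle)
  moreover have "\<dots> = pair_prod n (\<lambda>u. th (- u)) z * pair_prod n (\<lambda>u. th (h - u)) mu"
    by (simp add: case_prod_unfold prod.distrib pair_prod_def algebra_simps)
  ultimately show ?thesis
    using A_mat_triangular[OF permutes_id J z] by (metis (no_types, lifting))
qed

end

section \<open>The dual exchange relation\<close>

lemma adjacent_transposition_induct [consumes 1, case_names base step]:
  assumes "J permutes {1..n}" and "P (longest n)"
    and step: "\<And>a J. 1 \<le> a \<Longrightarrow> a < n \<Longrightarrow> J permutes {1..n} \<Longrightarrow> P J \<Longrightarrow> P (adj a \<circ> J)"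
  shows "P J"
proof -
  have transp: "P (Transposition.transpose a (a + d) \<circ> J)"
    if "1 \<le> a" "a + d \<le> n" "J permutes {1..n}" "P J" for a d J
    using that
  proof (induction d arbitrary: J)
    case (Suc d)
    let ?s = "adj (a + d)"
    have s: "?s permutes {1..n}" "Transposition.transpose a (a + d) permutes {1..n}"
      using Suc.prems by (auto intro!: permutes_swap_id)
    show ?case
    proof (cases "d = 0")
      case True
      then show ?thesis
        using step[of a J] Suc.prems by (simp add: o_def)
    next
      case False
      \<comment> \<open>A longer transposition is the conjugate of one shorter by 1 under an
        adjacent transposition; for d = 0 it is itself adjacent and must be treated apart.\<close>
      have eq: "Transposition.transpose a (a + Suc d) \<circ> J =
          ?s \<circ> (Transposition.transpose a (a + d) \<circ> (?s \<circ> J))"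
        using False by (auto simp: fun_eq_iff Transposition.transpose_def)
      have sJ: "?s \<circ> J permutes {1..n}"
        by (rule permutes_compose[OF Suc.prems(3) s(1)])
      have PsJ: "P (?s \<circ> J)"
        by (rule step) (use Suc.prems in auto)
      have "P (Transposition.transpose a (a + d) \<circ> (?s \<circ> J))"
        by (rule Suc.IH[OF _ _ sJ PsJ]) (use Suc.prems in auto)
      from step[OF _ _ permutes_compose[OF sJ s(2)] this, of "a + d"] show ?thesis
        unfolding eq using Suc.prems(1,2) by (simp only: add_Suc_right)
    qed
  qed simp
  have transp': "P (Transposition.transpose a b \<circ> J)"
    if "a \<in> {1..n}" "b \<in> {1..n}" "J permutes {1..n}" "P J" for a b J
  proof (cases "a \<le> b")
    case True
    then show ?thesis
      using transp[of a "b - a" J] that by simp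
  next
    case False
    then show ?thesis
      using transp[of b "a - b" J] that by (simp add: transpose_commute)
  qed
  have "P (p \<circ> longest n)" if "p permutes {1..n}" for p
  proof (rule permutes_induct[OF that])
    show "P (id \<circ> longest n)"
      using assms(2) by simp
    fix a b p
    assume "a \<in> {1..n}" "b \<in> {1..n}" "a \<noteq> b" "P (p \<circ> longest n)" "p permutes {1..n}"
    then show "P (Transposition.transpose a b \<circ> p \<circ> longest n)"
      unfolding comp_assoc by (intro transp' permutes_compose[OF longest_permutes])
  qed simp
  from this[OF permutes_compose[OF longest_permutes assms(1)]] show ?thesis
    by (simp add: o_def)
qed

context nome
begin

text \<open>The image of the relation \<open>A_mat_exchange\<close> under the duality to be proved.\<close>

definition dual_exchange :: "complex \<Rightarrow> nat \<Rightarrow> nat \<Rightarrow> (nat \<Rightarrow> nat) \<Rightarrow> bool" where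
  "dual_exchange h n b J \<longleftrightarrow> (\<forall>I z mu. I permutes {1..n} \<longrightarrow> generic_seq h n z \<longrightarrow> generic_seq h n mu \<longrightarrow>
    (let nu = z (J (Suc b)) - z (J b); m = mu (Suc b) - mu b in
      th nu * th (h + m) * A_mat n q h (I \<circ> adj b) J z (mu \<circ> adj b) =
      th h * th (nu - m) * A_mat n q h I J z mu + th (h + nu) * th m * A_mat n q h I (J \<circ> adj b) z mu))"

text \<open>At the longest permutation, exchanging positions b, b + 1 is the same as exchanging
  values a, a + 1 with a = n - b. So \<open>A_mat_exchange\<close> gives the one unknown entry, and
  every term vanishes unless \<open>I\<close> is the longest permutation or its product with
  \<open>adj b\<close>.\<close>

lemma dual_exchange_longest:
  assumes b: "1 \<le> b" "b < n"
  shows "dual_exchange h n b (longest n)"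
  unfolding dual_exchange_def Let_def
proof (intro allI impI)
  fix I z mu
  assume I: "I permutes {1..n}" and z: "generic_seq h n z" and mu: "generic_seq h n mu"
  define a where "a = n - b"
  have a: "1 \<le> a" "a < n"
    using b by (auto simp: a_def)
  have mem: "a \<in> {1..n}" "Suc a \<in> {1..n}" "b \<in> {1..n}" "Suc b \<in> {1..n}"
    using a b by auto
  have w: "longest n b = Suc a" "longest n (Suc b) = a" "longest n a = Suc b" "longest n (Suc a) = b"
    using b by (auto simp: longest_def a_def)
  let ?w = "longest n"
  have comm: "adj a \<circ> ?w = ?w \<circ> adj b"
  proof
    fix k
    have "?w k = a \<longleftrightarrow> k = Suc b" "?w k = Suc a \<longleftrightarrow> k = b"
      using w by (metis longest_longest)+
    then show "(adj a \<circ> ?w) k = (?w \<circ> adj b) k"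
      using w by (auto simp: Transposition.transpose_def)
  qed
  note adj_a = adj_permutes[OF a] and adj_b = adj_permutes[OF b]
  \<comment> \<open>Applied at \<open>z'\<close>, the exchange relation has \<open>z\<close> on its
    left side, so the unknown entry is expressed by entries of the known column.\<close>
  define z' where "z' = z \<circ> adj a"
  have z': "generic_seq h n z'"
    unfolding z'_def by (rule generic_seq_permutes[OF z adj_a])
  define nu m where "nu = z a - z (Suc a)" and "m = mu (Suc b) - mu b"
  define l where "l = mu (inv I (Suc a)) - mu (inv I a)"
  have z'_diff: "z' a - z' (Suc a) = - nu"
    by (simp add: z'_def nu_def)
  have zz: "z' \<circ> adj a = z"
    by (simp add: z'_def comp_assoc)
  have ex: "th l * th (h - nu) * A_mat n q h I (?w \<circ> adj b) z mu =
      th h * th (l + nu) * A_mat n q h I ?w z' mu - th (h + l) * th nu * A_mat n q h (adj a \<circ> I) ?w z' mu"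
    using A_mat_exchange[OF I longest_permutes a z' mu] unfolding zz z'_diff comm
    by (simp add: l_def th_minus)
  have nz: "th nu \<noteq> 0" "th m \<noteq> 0" "th (h + nu) \<noteq> 0" "th (h - nu) \<noteq> 0"
    using generic_seqD[OF z mem(1,2)] generic_seqD(2)[OF z mem(2,1)] generic_seqD(1)[OF mu mem(4,3)]
    by (simp_all add: nu_def m_def algebra_simps)
  have inv: "inv I a \<in> {1..n}" "inv I (Suc a) \<in> {1..n}" "inv I (Suc a) \<noteq> inv I a"
    using mem permutes_in_image[OF permutes_inv[OF I]] inj_eq[OF permutes_inj[OF permutes_inv[OF I]]] by auto
  have l_nz: "th l \<noteq> 0"
    unfolding l_def by (rule generic_seqD(1)[OF mu inv(2,1,3)])
  define D where "D = pair_prod n (\<lambda>u. th (h + u)) z * pair_prod n (\<lambda>u. th (- u)) mu"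
  define D' where "D' = pair_prod n (\<lambda>u. th (h + u)) z' * pair_prod n (\<lambda>u. th (- u)) mu"
  \<comment> \<open>The swap changes the orientation of one pair only, so the two products differ by
    the single factor of that pair.\<close>
  have D': "D' * th (h + nu) = D * th (h - nu)"
    using pair_prod_adj[OF a, of "\<lambda>u. th (h + u)" z]
    by (simp add: D_def D'_def z'_def nu_def algebra_simps)
  have A0: "A_mat n q h K ?w z mu = (if K = ?w then D else 0)"
    "A_mat n q h K ?w z' mu = (if K = ?w then D' else 0)" if "K permutes {1..n}" for K
    using A_mat_longest[OF that z] A_mat_longest[OF that z'] by (simp_all add: D_def D'_def)
  have "pair_prod n (\<lambda>u. th (- u)) (mu \<circ> adj b) * th m = - pair_prod n (\<lambda>u. th (- u)) mu * th m"
    using pair_prod_adj[OF b, of "\<lambda>u. th (- u)" mu] th_minus[of m]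
    by (simp add: m_def)
  then have "pair_prod n (\<lambda>u. th (- u)) (mu \<circ> adj b) = - pair_prod n (\<lambda>u. th (- u)) mu"
    using nz(2) by (simp only: mult_cancel_right) simp
  then have A1: "A_mat n q h K ?w z (mu \<circ> adj b) = (if K = ?w then - D else 0)" if "K permutes {1..n}" for K
    using A_mat_longest[OF that z, of "mu \<circ> adj b"] by (simp add: D_def)
  have Ib: "I \<circ> adj b permutes {1..n}" "adj a \<circ> I permutes {1..n}"
    by (intro permutes_compose I adj_a adj_b)+
  have eq1: "I \<circ> adj b = ?w \<longleftrightarrow> I = ?w \<circ> adj b"
    by (metis comp_assoc transpose_comp_involutory comp_id)
  have eq2: "adj a \<circ> I = ?w \<longleftrightarrow> I = ?w \<circ> adj b"
    unfolding comm[symmetric] by (metis comp_assoc transpose_comp_involutory id_comp)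
  have ne: "?w \<circ> adj b \<noteq> ?w"
    by (metis comp_apply transpose_apply_first w(1,2) n_not_Suc_n)
  have "th nu * th (h + m) * A_mat n q h (I \<circ> adj b) ?w z (mu \<circ> adj b) =
      th h * th (nu - m) * A_mat n q h I ?w z mu + th (h + nu) * th m * A_mat n q h I (?w \<circ> adj b) z mu"
  proof -
    consider "I = ?w" | "I = ?w \<circ> adj b" | "I \<noteq> ?w" "I \<noteq> ?w \<circ> adj b"
      by blast
    then show ?thesis
    proof cases
      case 1
      have "l = - m"
        using 1 w by (simp add: l_def m_def inv_longest)
      then have "- (th m * th (h - nu) * A_mat n q h I (?w \<circ> adj b) z mu) = th h * th (nu - m) * D'"
        using ex A0(2)[OF I] A0(2)[OF Ib(2)] eq2 1 ne[symmetric] by (simp add: th_minus)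
      then have "th m * th (h - nu) * A_mat n q h I (?w \<circ> adj b) z mu = - (th h * th (nu - m) * D')"
        by (metis minus_minus)
      then have "th h * th (nu - m) * (th (h - nu) * D) +
          th (h + nu) * (th m * th (h - nu) * A_mat n q h I (?w \<circ> adj b) z mu) =
          th h * th (nu - m) * (D * th (h - nu) - D' * th (h + nu))"
        by (simp only: right_diff_distrib) simp
      then have "th (h - nu) * (th h * th (nu - m) * D + th (h + nu) * th m * A_mat n q h I (?w \<circ> adj b) z mu) = 0"
        unfolding D' by (simp add: algebra_simps)
      then show ?thesis
        using nz A0(1)[OF I] A1[OF Ib(1)] eq1 1 ne[symmetric] D' by simp
    next
      case 2
      have "inv I = adj b \<circ> ?w"
        unfolding 2 using permutes_bij[OF longest_permutes] by (simp add: o_inv_distrib inv_longest inv_transpose)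
      then have "l = m"
        using w by (simp add: l_def m_def)
      then have "th m * th (h - nu) * A_mat n q h I (?w \<circ> adj b) z mu = - (th (h + m) * th nu * D')"
        using ex A0(2)[OF I] A0(2)[OF Ib(2)] eq2 2 ne by simp
      then have "th (h + nu) * (th m * th (h - nu) * A_mat n q h I (?w \<circ> adj b) z mu) =
          - (th (h + m) * th nu * (D' * th (h + nu)))"
        by simp
      then have "th (h - nu) * (th (h + nu) * th m * A_mat n q h I (?w \<circ> adj b) z mu) =
          - (th (h + m) * th nu * (D' * th (h + nu)))"
        by (simp only: mult_ac)
      also have "\<dots> = th (h - nu) * (th nu * th (h + m) * - D)"
        unfolding D' by (simp add: algebra_simps)
      finally have "th (h + nu) * th m * A_mat n q h I (?w \<circ> adj b) z mu = th nu * th (h + m) * - D"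
        using nz(4) by (simp only: mult_cancel_left) simp
      moreover have "A_mat n q h I ?w z mu = 0" "A_mat n q h (I \<circ> adj b) ?w z (mu \<circ> adj b) = - D"
        using A0(1)[OF I] A1[OF Ib(1)] eq1 2 ne by simp_all
      ultimately show ?thesis
        by simp
    next
      case 3
      then have "A_mat n q h I (?w \<circ> adj b) z mu = 0"
        using ex A0(2)[OF I] A0(2)[OF Ib(2)] eq2 nz l_nz by simp
      then show ?thesis
        using A0(1)[OF I] A1[OF Ib(1)] eq1 3 by simp
    qed
  qed
  then show "th (z (?w (Suc b)) - z (?w b)) * th (h + (mu (Suc b) - mu b)) * A_mat n q h (I \<circ> adj b) ?w z (mu \<circ> adj b) =
      th h * th (z (?w (Suc b)) - z (?w b) - (mu (Suc b) - mu b)) * A_mat n q h I ?w z mu +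
      th (h + (z (?w (Suc b)) - z (?w b))) * th (mu (Suc b) - mu b) * A_mat n q h I (?w \<circ> adj b) z mu"
    by (simp add: w nu_def m_def)
qed

text \<open>The two exchange relations commute: the coefficients of either one are invariant
  under the exchange performed by the other.\<close>

lemma dual_exchange_step:
  assumes a: "1 \<le> a" "a < n" and b: "1 \<le> b" "b < n" and J: "J permutes {1..n}"
    and dual: "dual_exchange h n b J"
  shows "dual_exchange h n b (adj a \<circ> J)"
  unfolding dual_exchange_def Let_def
proof (intro allI impI)
  fix I z mu
  assume I: "I permutes {1..n}" and z: "generic_seq h n z" and mu: "generic_seq h n mu"
  note adj_a = adj_permutes[OF a] and adj_b = adj_permutes[OF b]
  define z' where "z' = z \<circ> adj a"
  have z': "generic_seq h n z'"
    unfolding z'_def by (rule generic_seq_permutes[OF z adj_a])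
  have zz: "z' \<circ> adj a = z"
    by (simp add: z'_def comp_assoc)
  have mu': "generic_seq h n (mu \<circ> adj b)"
    by (rule generic_seq_permutes[OF mu adj_b])
  define nu m where "nu = z' (J (Suc b)) - z' (J b)" and "m = mu (Suc b) - mu b"
  define l x where "l = mu (inv I (Suc a)) - mu (inv I a)" and "x = z' a - z' (Suc a)"
  have mem: "a \<in> {1..n}" "Suc a \<in> {1..n}"
    using a by auto
  have inv: "inv I a \<in> {1..n}" "inv I (Suc a) \<in> {1..n}" "inv I (Suc a) \<noteq> inv I a"
    using mem permutes_in_image[OF permutes_inv[OF I]] inj_eq[OF permutes_inj[OF permutes_inv[OF I]]] by auto
  have nz: "th l * th (h + x) \<noteq> 0"
    using generic_seqD(1)[OF mu inv(2,1,3)] generic_seqD(2)[OF z' mem] by (simp add: l_def x_def)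
  have ex: "th l * th (h + x) * A_mat n q h I (adj a \<circ> K) z mu =
      th h * th (l - x) * A_mat n q h I K z' mu + th (h + l) * th x * A_mat n q h (adj a \<circ> I) K z' mu"
    if "K permutes {1..n}" for K
    using A_mat_exchange[OF I that a z' mu] unfolding zz l_def x_def .
  have "inv (I \<circ> adj b) = adj b \<circ> inv I"
    using permutes_bij[OF I] by (simp add: o_inv_distrib inv_transpose)
  \<comment> \<open>Exchanging positions in \<open>I\<close> together with the entries of mu
    preserves mu at the position of each value; so the coefficients of the first relation are
    unchanged.\<close>
  then have l': "(mu \<circ> adj b) (inv (I \<circ> adj b) (Suc a)) - (mu \<circ> adj b) (inv (I \<circ> adj b) a) = l"
    by (simp add: l_def)
  have ex': "th l * th (h + x) * A_mat n q h (I \<circ> adj b) (adj a \<circ> J) z (mu \<circ> adj b) =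
      th h * th (l - x) * A_mat n q h (I \<circ> adj b) J z' (mu \<circ> adj b) +
      th (h + l) * th x * A_mat n q h (adj a \<circ> I \<circ> adj b) J z' (mu \<circ> adj b)"
    using A_mat_exchange[OF permutes_compose[OF adj_b I] J a z' mu', unfolded l'] unfolding zz x_def comp_assoc .
  have d: "th nu * th (h + m) * A_mat n q h (K \<circ> adj b) J z' (mu \<circ> adj b) =
      th h * th (nu - m) * A_mat n q h K J z' mu + th (h + nu) * th m * A_mat n q h K (J \<circ> adj b) z' mu"
    if "K permutes {1..n}" for K
    using dual that z' mu unfolding dual_exchange_def Let_def nu_def m_def by blast
  \<comment> \<open>Three quantities expand by one relation with common coefficients c1, c2, and the
    parts satisfy the other relation with common p, r, s. Then the whole satisfies it too.\<close>
  have comb: "p * (c * X) = r * (c * Y) + s * (c * Z)"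
    if "c * X = c1 * X1 + c2 * X2" "c * Y = c1 * Y1 + c2 * Y2" "c * Z = c1 * Z1 + c2 * Z2"
      "p * X1 = r * Y1 + s * Z1" "p * X2 = r * Y2 + s * Z2"
    for p r s c c1 c2 X X1 X2 Y Y1 Y2 Z Z1 Z2 :: complex
  proof -
    have "p * (c * X) = c1 * (p * X1) + c2 * (p * X2)"
      unfolding that(1) by (simp add: algebra_simps)
    then show ?thesis
      unfolding that(2-5) by (simp add: algebra_simps)
  qed
  have "th nu * th (h + m) * (th l * th (h + x) * A_mat n q h (I \<circ> adj b) (adj a \<circ> J) z (mu \<circ> adj b)) =
      th h * th (nu - m) * (th l * th (h + x) * A_mat n q h I (adj a \<circ> J) z mu) +
      th (h + nu) * th m * (th l * th (h + x) * A_mat n q h I (adj a \<circ> (J \<circ> adj b)) z mu)"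
    by (rule comb[OF ex' ex[OF J] ex[OF permutes_compose[OF adj_b J]] d[OF I] d[OF permutes_compose[OF I adj_a]]])
  then have "th l * th (h + x) * (th nu * th (h + m) * A_mat n q h (I \<circ> adj b) (adj a \<circ> J) z (mu \<circ> adj b)) =
      th l * th (h + x) * (th h * th (nu - m) * A_mat n q h I (adj a \<circ> J) z mu +
      th (h + nu) * th m * A_mat n q h I (adj a \<circ> J \<circ> adj b) z mu)"
    by (simp only: comp_assoc distrib_left mult_ac)
  then have "th nu * th (h + m) * A_mat n q h (I \<circ> adj b) (adj a \<circ> J) z (mu \<circ> adj b) =
      th h * th (nu - m) * A_mat n q h I (adj a \<circ> J) z mu +
      th (h + nu) * th m * A_mat n q h I (adj a \<circ> J \<circ> adj b) z mu"
    using nz by (simp only: mult_cancel_left) blast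
  then show "th (z ((adj a \<circ> J) (Suc b)) - z ((adj a \<circ> J) b)) * th (h + (mu (Suc b) - mu b)) *
        A_mat n q h (I \<circ> adj b) (adj a \<circ> J) z (mu \<circ> adj b) =
      th h * th (z ((adj a \<circ> J) (Suc b)) - z ((adj a \<circ> J) b) - (mu (Suc b) - mu b)) *
        A_mat n q h I (adj a \<circ> J) z mu +
      th (h + (z ((adj a \<circ> J) (Suc b)) - z ((adj a \<circ> J) b))) * th (mu (Suc b) - mu b) *
        A_mat n q h I (adj a \<circ> J \<circ> adj b) z mu"
    by (simp add: nu_def m_def z'_def)
qed

section \<open>The dual relation for all J, and the duality at generic points\<close>

lemma A_mat_dual_exchange:
  assumes "I permutes {1..n}" "J permutes {1..n}" "1 \<le> b" "b < n" "generic_seq h n z" "generic_seq h n mu"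
  defines "nu \<equiv> z (J (Suc b)) - z (J b)" and "m \<equiv> mu (Suc b) - mu b"
  shows "th nu * th (h + m) * A_mat n q h (I \<circ> adj b) J z (mu \<circ> adj b) =
      th h * th (nu - m) * A_mat n q h I J z mu + th (h + nu) * th m * A_mat n q h I (J \<circ> adj b) z mu"
proof -
  have "dual_exchange h n b J"
    using assms(2)
  proof (induction rule: adjacent_transposition_induct)
    case base
    then show ?case
      by (rule dual_exchange_longest[OF assms(3,4)])
  next
    case (step a J)
    then show ?case
      by (intro dual_exchange_step assms(3,4))
  qed
  then show ?thesis
    using assms(1,5,6) unfolding dual_exchange_def Let_def nu_def m_def by blast
qed

text \<open>The induction on J leaves \<open>I\<close> and \<open>z\<close> free, because one
  exchange step mixes \<open>I\<close> with \<open>adj a \<circ> I\<close> and moves z. At the start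
  both sides are explicit: the left one lies in the column of the longest permutation, the right one
  in the row of the identity.\<close>

lemma A_mat_duality_generic:
  assumes J: "J permutes {1..n}" and "I permutes {1..n}" "generic_seq h n z" "generic_seq h n mu"
  shows "A_mat n q h I J z mu = (- 1) ^ (n * (n - 1) div 2) *
    A_mat n q h (longest n \<circ> inv J) (longest n \<circ> inv I) (mu \<circ> longest n) (\<lambda>i. - z i)"
  using assms
proof (induction arbitrary: I z rule: adjacent_transposition_induct)
  case base
  let ?w = "longest n"
  have w: "?w \<circ> inv ?w = id"
    by (simp add: inv_longest fun_eq_iff)
  let ?P = "pair_prod n (\<lambda>u. th (h + u)) z" and ?Q = "pair_prod n (\<lambda>u. th (- u)) mu"
  have iff: "?w \<circ> inv I = id \<longleftrightarrow> I = ?w"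
  proof
    assume eq: "?w \<circ> inv I = id"
    show "I = ?w"
    proof
      fix k
      have "?w (inv I (I k)) = I k"
        using fun_cong[OF eq, of "I k"] by simp
      then show "I k = ?w k"
        using permutes_inverses(2)[OF base(1)] by simp
    qed
  qed (use w in simp)
  \<comment> \<open>The origin of the sign: reversing mu replaces each factor of the product by
    theta of the negated argument.\<close>
  have Q: "pair_prod n (\<lambda>u. th (- u)) (mu \<circ> ?w) = (- 1) ^ (n * (n - 1) div 2) * ?Q"
  proof -
    have "pair_prod n (\<lambda>u. th (- u)) (mu \<circ> ?w) =
        (\<Prod>(v, w) | v \<in> {1..n} \<and> w \<in> {1..n} \<and> v < w. th (mu (?w w) - mu (?w v)))"
      by (simp add: pair_prod_def)
    also have "\<dots> = (\<Prod>(v, w) | v \<in> {1..n} \<and> w \<in> {1..n} \<and> v < w. th (mu v - mu w))"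
      by (rule prod_pairs_longest)
    also have "\<dots> = (\<Prod>(v, w) | v \<in> {1..n} \<and> w \<in> {1..n} \<and> v < w. (- 1) * th (- (mu v - mu w)))"
      by (intro prod.cong) (auto simp: th_minus simp del: minus_diff_eq)
    also have "\<dots> = (\<Prod>(v, w) | v \<in> {1..n} \<and> w \<in> {1..n} \<and> v < w. - 1) * pair_prod n (\<lambda>u. th (- u)) mu"
      unfolding pair_prod_def case_prod_unfold by (rule prod.distrib)
    finally show ?thesis
      by (simp only: prod_pairs_minus_one)
  qed
  have P: "pair_prod n (\<lambda>u. th (h - u)) (\<lambda>i. - z i) = ?P"
    by (simp add: pair_prod_def algebra_simps)
  have sq: "?P * ?Q = (- 1) ^ (n * (n - 1) div 2) * ((- 1) ^ (n * (n - 1) div 2) * ?Q * ?P)"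
    by (simp flip: power_mult_distrib mult.assoc)
  show ?case
    unfolding w A_mat_longest[OF base(1,2)] iff P Q
      A_mat_id[OF permutes_compose[OF permutes_inv[OF base(1)] longest_permutes]
        generic_seq_permutes[OF base(3) longest_permutes]]
    by (simp only: sq if_distrib[of "\<lambda>x. (- 1) ^ (n * (n - 1) div 2) * x"] mult_zero_right)
next
  case (step a J)
  let ?w = "longest n" and ?s = "(- 1 :: complex) ^ (n * (n - 1) div 2)"
  note a = step(1,2) and J = step(3) and I = step.prems(1) and z = step.prems(2) and mu = step.prems(3)
  note adj = adj_permutes[OF a]
  define z' where "z' = z \<circ> adj a"
  have z': "generic_seq h n z'"
    unfolding z'_def by (rule generic_seq_permutes[OF z adj])
  have zz: "z' \<circ> adj a = z"
    by (simp add: z'_def comp_assoc)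
  define l x where "l = mu (inv I (Suc a)) - mu (inv I a)" and "x = z' a - z' (Suc a)"
  have mem: "a \<in> {1..n}" "Suc a \<in> {1..n}"
    using a by auto
  have inv: "inv I a \<in> {1..n}" "inv I (Suc a) \<in> {1..n}" "inv I (Suc a) \<noteq> inv I a"
    using mem permutes_in_image[OF permutes_inv[OF I]] inj_eq[OF permutes_inj[OF permutes_inv[OF I]]] by auto
  have nz: "th l * th (h + x) \<noteq> 0"
    using generic_seqD(1)[OF mu inv(2,1,3)] generic_seqD(2)[OF z' mem] by (simp add: l_def x_def)
  have perm: "?w \<circ> inv K permutes {1..n}" if "K permutes {1..n}" for K
    by (rule permutes_compose[OF permutes_inv[OF that] longest_permutes])
  have invI: "?w \<circ> inv (adj a \<circ> K) = ?w \<circ> inv K \<circ> adj a" if "K permutes {1..n}" for K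
    using inv_adj_comp[OF permutes_bij[OF that]] by (simp add: comp_assoc)
  have "(\<lambda>i. - z' i) \<circ> adj a = (\<lambda>i. - z i)"
    by (simp add: z'_def fun_eq_iff)
  \<comment> \<open>The coefficients agree with those on the left: the difference of
    \<open>mu \<circ> longest n\<close> at the entries of \<open>longest n \<circ> inv I\<close> is
    \<open>l\<close>, and the difference of the negated z' is \<open>x\<close>.\<close>
  then have dual: "th l * th (h + x) * A_mat n q h (?w \<circ> inv J \<circ> adj a) (?w \<circ> inv I) (mu \<circ> ?w) (\<lambda>i. - z i) =
      th h * th (l - x) * A_mat n q h (?w \<circ> inv J) (?w \<circ> inv I) (mu \<circ> ?w) (\<lambda>i. - z' i) +
      th (h + l) * th x * A_mat n q h (?w \<circ> inv J) (?w \<circ> inv I \<circ> adj a) (mu \<circ> ?w) (\<lambda>i. - z' i)"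
    using A_mat_dual_exchange[OF perm[OF J] perm[OF I] a generic_seq_permutes[OF mu longest_permutes] generic_seq_minus[OF z']]
    by (simp add: l_def x_def)
  have "th l * th (h + x) * A_mat n q h I (adj a \<circ> J) z mu =
      th h * th (l - x) * A_mat n q h I J z' mu + th (h + l) * th x * A_mat n q h (adj a \<circ> I) J z' mu"
    using A_mat_exchange[OF I J a z' mu] unfolding zz l_def x_def .
  also have "\<dots> = ?s * (th h * th (l - x) * A_mat n q h (?w \<circ> inv J) (?w \<circ> inv I) (mu \<circ> ?w) (\<lambda>i. - z' i) +
      th (h + l) * th x * A_mat n q h (?w \<circ> inv J) (?w \<circ> inv I \<circ> adj a) (mu \<circ> ?w) (\<lambda>i. - z' i))"
    unfolding step.IH[OF I z' mu] step.IH[OF permutes_compose[OF I adj] z' mu] invI[OF I]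
    by (simp only: distrib_left mult_ac)
  also have "\<dots> = th l * th (h + x) * (?s * A_mat n q h (?w \<circ> inv J \<circ> adj a) (?w \<circ> inv I) (mu \<circ> ?w) (\<lambda>i. - z i))"
    unfolding dual[symmetric] by (simp only: mult_ac)
  finally show ?case
    unfolding invI[OF J] using nz by (simp only: mult_cancel_left) blast
qed

end

section \<open>Passage to non-generic points\<close>

text \<open>A punctured disc around 0 is uncountable. Avoiding the exceptional set frequently is
  enough, since both sides of the identity will be known to converge.\<close>

lemma frequently_at_0_if_countable:
  fixes S :: "complex set"
  assumes "countable S"
  shows "\<exists>\<^sub>F e in at 0. e \<notin> S"
  unfolding frequently_def
proof
  assume "\<forall>\<^sub>F e in at 0. \<not> e \<notin> S"
  then obtain d where d: "d > 0" "\<And>e. e \<noteq> 0 \<Longrightarrow> dist e 0 < d \<Longrightarrow> e \<in> S"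
    unfolding eventually_at by auto
  have "ball 0 d \<subseteq> insert 0 S"
  proof
    show "e \<in> insert 0 S" if "e \<in> ball 0 d" for e
      using d(2)[of e] that by (cases "e = 0") auto
  qed
  then have "countable (ball (0 :: complex) d)"
    by (rule countable_subset) (simp add: assms)
  then show False
    using uncountable_ball[OF d(1), of 0] by contradiction
qed

lemma tendsto_eq_if_frequently_eq:
  fixes f g :: "complex \<Rightarrow> complex"
  assumes "(f \<longlongrightarrow> a) (at 0)" "(g \<longlongrightarrow> b) (at 0)" "\<exists>\<^sub>F e in at 0. f e = g e"
  shows "a = b"
proof (rule ccontr)
  assume "a \<noteq> b"
  have "((\<lambda>e. f e - g e) \<longlongrightarrow> a - b) (at 0)"
    by (intro tendsto_intros assms)
  then have "\<forall>\<^sub>F e in at 0. f e - g e \<noteq> 0"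
    using \<open>a \<noteq> b\<close> by (intro tendsto_imp_eventually_ne) auto
  then have "\<forall>\<^sub>F e in at 0. f e \<noteq> g e"
    by eventually_elim simp
  with assms(3) show False
    by (simp add: frequently_def)
qed

context nome
begin

lemma th_tendsto [tendsto_intros]: "(f \<longlongrightarrow> l) F \<Longrightarrow> ((\<lambda>x. th (f x)) \<longlongrightarrow> th l) F"
  using th_continuous by (intro isCont_tendsto_compose[of l th]) (simp add: continuous_on_eq_continuous_at)

lemma rank_level_tendsto:
  assumes "\<And>i. ((\<lambda>e. mu e i) \<longlongrightarrow> mu0 i) F" "\<And>a. ((\<lambda>e. y e a) \<longlongrightarrow> y0 a) F" "\<And>a. ((\<lambda>e. x e a) \<longlongrightarrow> x0 a) F"
    and nz: "\<And>a b. a \<in> {1..k} \<Longrightarrow> b \<in> {1..k} \<Longrightarrow> a \<noteq> b \<Longrightarrow>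
      th (h + y0 a - y0 b) \<noteq> 0 \<and> th (y0 b - y0 a) \<noteq> 0"
  shows "((\<lambda>e. rank_level q h I (mu e) k (y e) (x e)) \<longlongrightarrow> rank_level q h I mu0 k y0 x0) F"
  unfolding rank_level_def
proof (rule tendsto_divide)
  have "((\<lambda>e. psi q h I (mu e) k a c (x e c - y e a)) \<longlongrightarrow> psi q h I mu0 k a c (x0 c - y0 a)) F" for a c
    unfolding psi_def
    by (cases "ith I (k + 1) c" "ith I k a" rule: linorder_cases) (auto intro!: tendsto_intros assms)
  then show "((\<lambda>e. \<Prod>a = 1..k. \<Prod>c = 1..k + 1. psi q h I (mu e) k a c (x e c - y e a)) \<longlongrightarrow>
      (\<Prod>a = 1..k. \<Prod>c = 1..k + 1. psi q h I mu0 k a c (x0 c - y0 a))) F"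
    by (intro tendsto_prod)
  show "((\<lambda>e. \<Prod>(a, b)\<in>{(a, b). 1 \<le> a \<and> a < b \<and> b \<le> k}. th (h + y e a - y e b) * th (y e b - y e a)) \<longlongrightarrow>
      (\<Prod>(a, b)\<in>{(a, b). 1 \<le> a \<and> a < b \<and> b \<le> k}. th (h + y0 a - y0 b) * th (y0 b - y0 a))) F"
    unfolding case_prod_unfold by (intro tendsto_prod tendsto_intros assms)
  have "finite {(a, b). 1 \<le> a \<and> a < b \<and> b \<le> k}"
    by (rule finite_subset[of _ "{1..k} \<times> {1..k}"]) auto
  then show "(\<Prod>(a, b)\<in>{(a, b). 1 \<le> a \<and> a < b \<and> b \<le> k}. th (h + y0 a - y0 b) * th (y0 b - y0 a)) \<noteq> 0"
    using nz by (auto simp: prod_zero_iff)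
qed

lemma nest_tendsto:
  assumes "\<And>i. ((\<lambda>e. mu e i) \<longlongrightarrow> mu0 i) F" "\<And>j a. ((\<lambda>e. t e j a) \<longlongrightarrow> t0 j a) F" "\<And>a. ((\<lambda>e. x e a) \<longlongrightarrow> x0 a) F"
    and "\<And>j a b. j < k \<Longrightarrow> a \<in> {1..j} \<Longrightarrow> b \<in> {1..j} \<Longrightarrow> a \<noteq> b \<Longrightarrow>
      th (h + t0 j a - t0 j b) \<noteq> 0 \<and> th (t0 j b - t0 j a) \<noteq> 0"
  shows "((\<lambda>e. nest (rank_level q h I (mu e)) (t e) k (x e)) \<longlongrightarrow> nest (rank_level q h I mu0) t0 k x0) F"
  using assms(3,4)
proof (induction k arbitrary: x x0)
  case (Suc k)
  show ?case
    unfolding nest.simps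
  proof (intro tendsto_sum tendsto_mult)
    fix p assume "p \<in> {p. p permutes {1..k}}"
    then have p: "p permutes {1..k}" by simp
    have t: "((\<lambda>e. (t e k \<circ> p) a) \<longlongrightarrow> (t0 k \<circ> p) a) F" for a
      using assms(2) by simp
    show "((\<lambda>e. rank_level q h I (mu e) k (t e k \<circ> p) (x e)) \<longlongrightarrow> rank_level q h I mu0 k (t0 k \<circ> p) x0) F"
    proof (rule rank_level_tendsto[OF assms(1) t Suc.prems(1)])
      fix a b assume "a \<in> {1..k}" "b \<in> {1..k}" "a \<noteq> b"
      then have "p a \<in> {1..k}" "p b \<in> {1..k}" "p a \<noteq> p b"
        using permutes_in_image[OF p] inj_eq[OF permutes_inj[OF p]] by auto
      then show "th (h + (t0 k \<circ> p) a - (t0 k \<circ> p) b) \<noteq> 0 \<and> th ((t0 k \<circ> p) b - (t0 k \<circ> p) a) \<noteq> 0"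
        using Suc.prems(2)[of k "p a" "p b"] by simp
    qed
    show "((\<lambda>e. nest (rank_level q h I (mu e)) (t e) k (t e k \<circ> p)) \<longlongrightarrow> nest (rank_level q h I mu0) t0 k (t0 k \<circ> p)) F"
      by (rule Suc.IH[OF t]) (rule Suc.prems(2), auto)
  qed
qed simp

lemma A_mat_tendsto:
  assumes "\<And>i. ((\<lambda>e. z e i) \<longlongrightarrow> z0 i) F" "\<And>i. ((\<lambda>e. mu e i) \<longlongrightarrow> mu0 i) F" "A_defined n q h J z0"
  shows "((\<lambda>e. A_mat n q h I J (z e) (mu e)) \<longlongrightarrow> A_mat n q h I J z0 mu0) F"
  unfolding A_mat_def W_fun_eq_nest
proof (rule nest_tendsto)
  show "((\<lambda>e. z_subst J (z e) j a) \<longlongrightarrow> z_subst J z0 j a) F" for j a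
    unfolding z_subst_def by (rule assms(1))
  show "th (h + z_subst J z0 j a - z_subst J z0 j b) \<noteq> 0 \<and> th (z_subst J z0 j b - z_subst J z0 j a) \<noteq> 0"
    if "j < n" "a \<in> {1..j}" "b \<in> {1..j}" "a \<noteq> b" for j a b
    using assms(3) that unfolding A_defined_def by (auto dest!: bspec[of _ _ j])
qed (rule assms)+

text \<open>The speeds i are pairwise distinct, so every difference of two coordinates is a
  nonconstant affine function of e, and theta of it has only countably many zeros.\<close>

lemma countable_not_generic_seq:
  "countable {e. \<not> generic_seq h n (\<lambda>i. z i + of_nat i * e)}"
proof (rule countable_subset)
  show "{e. \<not> generic_seq h n (\<lambda>i. z i + of_nat i * e)} \<subseteq>
    (\<Union>i\<in>{1..n}. \<Union>j\<in>{1..n} - {i}. {e. th ((of_nat i - of_nat j) * e + (z i - z j)) = 0} \<union>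
      {e. th ((of_nat i - of_nat j) * e + (h + (z i - z j))) = 0})"
    unfolding generic_seq_def by (auto simp: algebra_simps)
  show "countable (\<Union>i\<in>{1..n}. \<Union>j\<in>{1..n} - {i}. {e. th ((of_nat i - of_nat j) * e + (z i - z j)) = 0} \<union>
      {e. th ((of_nat i - of_nat j) * e + (h + (z i - z j))) = 0})"
    by (intro countable_UN countable_Un countable_th_affine_zeros) auto
qed

text \<open>Each of the two \<open>A_defined\<close> assumptions gives the limit of one side along a
  line of perturbed z and mu; the points of the line at which z or mu fails to be generic are
  countable.\<close>

theorem A_mat_duality:
  assumes I: "I permutes {1..n}" and J: "J permutes {1..n}" and "A_defined n q h J z"
    and "A_defined n q h (longest n \<circ> inv I) (mu \<circ> longest n)"
  shows "A_mat n q h I J z mu = (- 1) ^ (n * (n - 1) div 2) *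
    A_mat n q h (longest n \<circ> inv J) (longest n \<circ> inv I) (mu \<circ> longest n) (\<lambda>i. - z i)"
proof -
  define ze me where "ze e i = z i + of_nat i * e" and "me e i = mu i + of_nat i * e" for e i
  have lim: "((\<lambda>e. ze e i) \<longlongrightarrow> z i) (at 0)" "((\<lambda>e. me e i) \<longlongrightarrow> mu i) (at 0)" for i
    unfolding ze_def me_def by (rule tendsto_eq_intros refl | simp)+
  show ?thesis
  proof (rule tendsto_eq_if_frequently_eq)
    show "((\<lambda>e. A_mat n q h I J (ze e) (me e)) \<longlongrightarrow> A_mat n q h I J z mu) (at 0)"
      by (rule A_mat_tendsto[OF lim assms(3)])
    show "((\<lambda>e. (- 1) ^ (n * (n - 1) div 2) *
          A_mat n q h (longest n \<circ> inv J) (longest n \<circ> inv I) (me e \<circ> longest n) (\<lambda>i. - ze e i)) \<longlongrightarrow>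
        (- 1) ^ (n * (n - 1) div 2) *
          A_mat n q h (longest n \<circ> inv J) (longest n \<circ> inv I) (mu \<circ> longest n) (\<lambda>i. - z i)) (at 0)"
      by (intro tendsto_mult tendsto_const A_mat_tendsto assms(4)) (auto intro!: tendsto_minus lim)
    have "\<exists>\<^sub>F e in at 0. e \<notin> {e. \<not> generic_seq h n (ze e)} \<union> {e. \<not> generic_seq h n (me e)}"
      unfolding ze_def me_def
      by (intro frequently_at_0_if_countable countable_Un countable_not_generic_seq)
    then show "\<exists>\<^sub>F e in at 0. A_mat n q h I J (ze e) (me e) = (- 1) ^ (n * (n - 1) div 2) *
        A_mat n q h (longest n \<circ> inv J) (longest n \<circ> inv I) (me e \<circ> longest n) (\<lambda>i. - ze e i)"
      by (rule frequently_elim1) (use A_mat_duality_generic[OF J I] in blast)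
  qed
qed

end

theorem theorem3p10:
  fixes n :: nat and q h :: complex and I J :: "nat \<Rightarrow> nat" and z mu :: "nat \<Rightarrow> complex"
  assumes "q \<noteq> 0" and "norm q < 1"
    and "I permutes {1..n}" and "J permutes {1..n}"
    and "A_defined n q h J z"
    and "A_defined n q h (perm_dot (inv I) (longest n)) (\<lambda>i. mu (longest n i))"
  shows "A_mat n q h I J z mu =
    (- 1) ^ (n * (n - 1) div 2) *
    A_mat n q h (perm_dot (inv J) (longest n)) (perm_dot (inv I) (longest n))
      (\<lambda>i. mu (longest n i)) (\<lambda>i. - z i)"
proof -
  interpret nome q
    by unfold_locales (rule assms(1,2))+
  have "(\<lambda>i. mu (longest n i)) = mu \<circ> longest n"
    by (simp add: fun_eq_iff)
  with assms(6) show ?thesis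
    unfolding perm_dot_def by (simp only: A_mat_duality[OF assms(3-5)])
qed

end
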